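(* Let $\Omega\subseteq M$ be a domain and let $f,g:\Omega\rightarrow\mathbb{A}$ be (left) monogenic functions with respect to $\mathcal{B}$. If $f=g$ on a nonempty $m$-dimensional smooth submanifold of $\Omega$, then $f\equiv g$ in $\Omega$.
   Context: $\mathbb{A}$ is a real algebra with unity (with $\mathbb{R}$ identified with $\mathbb{R}\cdot 1$), of finite real dimension greater than $1$, which is alternative (not necessarily associative or commutative): the associator $[a,b,c]=(ab)c-a(bc)$ is an alternating trilinear function. It is equipped with an anti-involution $a\mapsto a^{c}$, i.e. a real linear map with $a^{c}=a$ for $a\in\mathbb{R}$, $(a^{c})^{c}=a$, $(ab)^{c}=b^{c}a^{c}$. Put $t(x)=x+x^{c}$, $n(x)=xx^{c}$, $\mathbb{S}_{\mathbb{A}}=\{x\in\mathbb{A}: t(x)=0,\ n(x)=1\}$ (assumed nonempty), and $Q_{\mathbb{A}}=\mathbb{R}\cup\{x\in\mathbb{A}: t(x)\in\mathbb{R},\ n(x)\in\mathbb{R},\ 4n(x)>t(x)^2\}$. $M$ is a fixed hypercomplex subspace of $\mathbb{A}$, i.e. a real vector subspace with $\mathbb{R}\subsetneq M\subseteq Q_{\mathbb{A}}$, with a fixed hypercomplex basis $\mathcal{B}=(v_0,v_1,\ldots,v_m)$, $m\ge 1$: a real vector basis of $M$ with $v_0=1$, $v_s\in\mathbb{S}_{\mathbb{A}}$ for $1\le s\le m$ and $v_sv_t=-v_tv_s$ for distinct $s,t\in\{1,\ldots,m\}$. The basis $\mathcal{B}$ is completed to a real vector basis of $\mathbb{A}$,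 and $\mathbb{A}$ carries the Euclidean scalar product and norm $|\cdot|$ for which that basis is orthonormal. $\mathbb{R}^{m+1}$ is identified with $M$ via $(x_0,\ldots,x_m)\mapsto x=\sum_{s=0}^m x_sv_s$. A domain is a connected open set. Differentiability classes of $\mathbb{A}$-valued functions are understood componentwise; $\partial_s=\partial/\partial x_s$. A function $f\in C^1(\Omega,\mathbb{A})$ is (left) monogenic with respect to $\mathcal{B}$ if $\overline{\partial}_{\mathcal{B}}f:=\sum_{s=0}^m v_s\,\partial_s f=0$ in $\Omega$. *)

theory Defs
  imports "HOL-Analysis.Analysis"
begin

text \<open>
  The library's type classes for algebras with unity are associative, so the product and the
  unity \<open>e\<close> are explicit parameters over a Euclidean space; \<open>\<real>\<close> is identified with the multiples
  \<open>r *\<^sub>R e\<close>.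
\<close>

locale alternative_star_algebra =
  fixes mul :: "'a::euclidean_space \<Rightarrow> 'a \<Rightarrow> 'a" (infixl "\<odot>" 70)
    and e :: 'a
    and conj :: "'a \<Rightarrow> 'a"
  assumes dim_gt_1: "DIM('a) > 1"
    and bilinear_mul: "bilinear mul"
    and unit_left: "e \<odot> x = x"
    and unit_right: "x \<odot> e = x"
    \<comment> \<open>The associator is trilinear by bilinearity; it is alternating iff it vanishes whenever
      two of its arguments coincide.\<close>
    and assoc_left: "(a \<odot> a) \<odot> b - a \<odot> (a \<odot> b) = 0"
    and assoc_right: "(b \<odot> a) \<odot> a - b \<odot> (a \<odot> a) = 0"
    and assoc_flex: "(a \<odot> b) \<odot> a - a \<odot> (b \<odot> a) = 0"
    and linear_conj: "linear conj"
    and conj_real: "conj (r *\<^sub>R e) = r *\<^sub>R e"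
    and conj_conj: "conj (conj a) = a"
    and conj_mul: "conj (a \<odot> b) = conj b \<odot> conj a"
begin

definition alg_reals :: "'a set" where
  "alg_reals = range (\<lambda>r::real. r *\<^sub>R e)"

definition trace :: "'a \<Rightarrow> 'a" where
  "trace x = x + conj x"

definition sqnorm :: "'a \<Rightarrow> 'a" where
  "sqnorm x = x \<odot> conj x"

definition imag_units :: "'a set" where
  "imag_units = {x. trace x = 0 \<and> sqnorm x = e}"

definition quadratic_cone :: "'a set" where
  "quadratic_cone = alg_reals \<union>
     {x. \<exists>t n :: real. trace x = t *\<^sub>R e \<and> sqnorm x = n *\<^sub>R e \<and> 4 * n > t\<^sup>2}"

end

text \<open>
  Here \<open>v 0, \<dots>, v m\<close> is the hypercomplex basis of \<open>M\<close> and \<open>v 0, \<dots>, v (DIM('a) - 1)\<close> is its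
  completion to a basis of the algebra; the inner product of the type is the one for which
  this completed basis is orthonormal.
\<close>

locale hypercomplex_subspace = alternative_star_algebra mul e conj
  for mul :: "'a::euclidean_space \<Rightarrow> 'a \<Rightarrow> 'a" (infixl "\<odot>" 70)
    and e :: 'a
    and conj :: "'a \<Rightarrow> 'a" +
  fixes M :: "'a set"
    and m :: nat
    and v :: "nat \<Rightarrow> 'a"
  assumes imag_units_nonempty: "imag_units \<noteq> {}"
    and subspace_M: "subspace M"
    and reals_psubset_M: "alg_reals \<subset> M"
    and M_subset_cone: "M \<subseteq> quadratic_cone"
    and m_ge_1: "m \<ge> 1"
    and inj_v: "inj_on v {..m}"
    and independent_v: "independent (v ` {..m})"
    and span_v: "span (v ` {..m}) = M"
    and v_0: "v 0 = e"
    and v_unit: "s \<in> {1..m} \<Longrightarrow> v s \<in> imag_units"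
    and v_anticommute:
      "s \<in> {1..m} \<Longrightarrow> t \<in> {1..m} \<Longrightarrow> s \<noteq> t \<Longrightarrow> v s \<odot> v t = - (v t \<odot> v s)"
    and completed_span: "span (v ` {..<DIM('a)}) = UNIV"
    and completed_orthonormal:
      "i < DIM('a) \<Longrightarrow> j < DIM('a) \<Longrightarrow> v i \<bullet> v j = (if i = j then 1 else 0)"

text \<open>
  Calculus on sets \<open>U\<close> that are relatively open in the span of finitely many vectors \<open>B\<close>. The
  coordinates are those with respect to \<open>B\<close>, so partial derivatives are derivatives along the
  elements of \<open>B\<close>; they only depend on the values of the function on \<open>U\<close>.
\<close>

definition dir_deriv ::
  "'a::real_normed_vector \<Rightarrow> ('a \<Rightarrow> 'b::real_normed_vector) \<Rightarrow> 'a \<Rightarrow> 'b" where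
  "dir_deriv u f x = vector_derivative (\<lambda>t::real. f (x + t *\<^sub>R u)) (at 0)"

primrec Ck_on ::
  "nat \<Rightarrow> 'a::real_normed_vector set \<Rightarrow> 'a set \<Rightarrow> ('a \<Rightarrow> 'b::real_normed_vector) \<Rightarrow> bool" where
  "Ck_on 0 B U f \<longleftrightarrow> continuous_on U f"
| "Ck_on (Suc k) B U f \<longleftrightarrow>
     (\<forall>u\<in>B. (\<forall>x\<in>U. (\<lambda>t::real. f (x + t *\<^sub>R u)) differentiable (at 0)) \<and>
            Ck_on k B U (dir_deriv u f))"

definition smooth_map_on ::
  "'a::real_normed_vector set \<Rightarrow> 'a set \<Rightarrow> ('a \<Rightarrow> 'b::real_normed_vector) \<Rightarrow> bool" where
  "smooth_map_on B U f \<longleftrightarrow> (\<forall>k. Ck_on k B U f)"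

text \<open>
  Embedded (not necessarily closed) \<open>k\<close>-dimensional \<open>C\<^sup>\<infinity>\<close> submanifolds \<open>S\<close> of a set \<open>\<Omega>\<close> that is
  open in the \<open>(m+1)\<close>-dimensional span of \<open>v 0, \<dots>, v m\<close>, given by slice charts: diffeomorphisms
  \<open>\<phi>\<close> between open sets that flatten \<open>S\<close> to the coordinate subspace on which the last \<open>m+1-k\<close>
  coordinates vanish.
\<close>

definition smooth_submanifold ::
  "(nat \<Rightarrow> 'a::real_normed_vector) \<Rightarrow> nat \<Rightarrow> nat \<Rightarrow> 'a set \<Rightarrow> 'a set \<Rightarrow> bool" where
  "smooth_submanifold v m k \<Omega> S \<longleftrightarrow>
     k \<le> m + 1 \<and> S \<subseteq> \<Omega> \<and>
     (\<forall>p\<in>S. \<exists>U V \<phi> \<psi>.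
        p \<in> U \<and> openin (top_of_set \<Omega>) U \<and> openin (top_of_set (span (v ` {..m}))) V \<and>
        homeomorphism U V \<phi> \<psi> \<and>
        smooth_map_on (v ` {..m}) U \<phi> \<and> smooth_map_on (v ` {..m}) V \<psi> \<and>
        \<phi> ` (S \<inter> U) = V \<inter> span (v ` {..<k}))"

definition monogenic_on ::
  "('a::real_normed_vector \<Rightarrow> 'a \<Rightarrow> 'a) \<Rightarrow> (nat \<Rightarrow> 'a) \<Rightarrow> nat \<Rightarrow> 'a set \<Rightarrow> ('a \<Rightarrow> 'a) \<Rightarrow> bool" where
  "monogenic_on mul v m \<Omega> f \<longleftrightarrow>
     Ck_on 1 (v ` {..m}) \<Omega> f \<and>
     (\<forall>x\<in>\<Omega>. (\<Sum>s\<le>m. mul (v s) (dir_deriv (v s) f x)) = 0)"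

end

(*
  Extend f - g to the whole algebra, constantly along the orthogonal complement of M. The extension
  F satisfies sum_s v_s (d_s F) = 0. Multiplying this by the conjugate of y = sum_s y_s v_s
  expresses the radial derivative of F through the rotation fields y_s d_t - y_t d_s, which
  integrate to zero against a radial weight. Hence F has the mean value property for the weight
  max(0, 1 - |y|^2)^2 although it is only assumed to be C^1. The mean value property shows that the
  derivatives of F are again solutions and satisfy Cauchy estimates, so F vanishes near every
  point where all its iterated derivatives vanish.

  If a solution vanishes on the hypersurface S, its derivative at a point of S has rank at most
  one, so d_s F = c_s b, and the equation reads (sum_s c_s v_s) b = 0. Multiplication by the
  conjugate of sum_s c_s v_s gives b = 0 or c = 0. So all first derivatives vanish on S and,
  being solutions themselves, so do all iterated ones; connectedness of the domain concludes.
*)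

theory Submission
  imports Defs
begin

section \<open>Continuously differentiable functions\<close>

text \<open>Two obstacles shape the proof. The product is not associative, so nested products cannot
  be regrouped. What survives is the polarised left alternative law, which makes left
  multiplications by distinct imaginary basis elements anticommute as operators; the analysis is
  therefore done for abstract families of linear maps \<open>L\<close>, \<open>L'\<close> and
  mentions no product. Moreover a solution is only C^1, so a second first-order operator cannot be
  applied to show that it is harmonic; a mean value property is derived from first derivatives
  alone. The weight is squared to have a continuous gradient: a derivative can then fall either on
  the weight or on the function, and using both at once yields second derivatives. The extension to
  the whole algebra makes integrals over a Euclidean space applicable to functions on
  \<open>M\<close>; a weight that is radial in the larger space is admissible because the extended
  function has no derivative across \<open>M\<close>. The Taylor argument runs along one segment at
  a time, so only powers of a single directional derivative occur, whence the conditions on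
  \<open>(dir_deriv u ^^ k) F\<close>.\<close>

lemma dir_deriv_eq:
  assumes "(f has_derivative f') (at x)"
  shows "dir_deriv u f x = f' u"
proof -
  have "(f \<circ> (\<lambda>t. x + t *\<^sub>R u) has_derivative f' \<circ> (\<lambda>t. t *\<^sub>R u)) (at 0)"
    by (rule diff_chain_at) (auto intro!: derivative_eq_intros assms)
  then have "((\<lambda>t. f (x + t *\<^sub>R u)) has_vector_derivative f' u) (at 0)"
    using linear_cmul[OF has_derivative_linear[OF assms]]
    by (simp add: has_vector_derivative_def o_def)
  then show ?thesis
    by (simp add: dir_deriv_def vector_derivative_at)
qed

lemma differentiable_dir_deriv:
  assumes "f differentiable (at x)"
  shows "(f has_derivative (\<lambda>u. dir_deriv u f x)) (at x)"
proof -
  obtain f' where "(f has_derivative f') (at x)"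
    using assms by (auto simp: differentiable_def)
  with dir_deriv_eq[OF this] show ?thesis by simp
qed

lemma has_vector_derivative_line:
  assumes "f differentiable (at (x + s *\<^sub>R u))"
  shows "((\<lambda>t. f (x + t *\<^sub>R u)) has_vector_derivative dir_deriv u f (x + s *\<^sub>R u)) (at s within T)"
proof -
  note d = differentiable_dir_deriv[OF assms]
  have "(f \<circ> (\<lambda>t. x + t *\<^sub>R u) has_derivative (\<lambda>w. dir_deriv w f (x + s *\<^sub>R u)) \<circ> (\<lambda>t. t *\<^sub>R u))
      (at s)"
    by (rule diff_chain_at) (auto intro!: derivative_eq_intros d)
  then show ?thesis
    using linear_cmul[OF has_derivative_linear[OF d]]
    by (auto simp: has_vector_derivative_def o_def intro: has_derivative_at_withinI)
qed

lemma has_vector_derivative_line_shift: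
  fixes u :: "'a::real_normed_vector"
  assumes "((\<lambda>t. f (x + s *\<^sub>R u + t *\<^sub>R u)) has_vector_derivative d) (at 0)"
  shows "((\<lambda>t. f (x + t *\<^sub>R u)) has_vector_derivative d) (at s)"
proof -
  have "((\<lambda>t. f (x + s *\<^sub>R u + t *\<^sub>R u)) \<circ> (\<lambda>t. t - s) has_vector_derivative 1 *\<^sub>R d) (at s)"
    by (rule vector_diff_chain_at) (use assms in \<open>auto intro!: derivative_eq_intros\<close>)
  moreover have "x + s *\<^sub>R u + (t - s) *\<^sub>R u = x + t *\<^sub>R u" for t
    using scaleR_left_diff_distrib[of t s u] by (simp add: algebra_simps)
  ultimately show ?thesis by (simp add: o_def)
qed

text \<open>Induction over the coordinates: the last one is moved along a segment and handled by the
  mean value inequality, the others by the induction hypothesis. Since \<open>J\<close> grows during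
  the induction, the moved vector is a partial sum of coordinates rather than \<open>h\<close>
  itself.\<close>

lemma partial_increment:
  fixes f :: "'a::real_normed_vector \<Rightarrow> 'b::real_normed_vector" and b :: "'i \<Rightarrow> 'a"
  assumes D: "open D" "x \<in> D" and J: "finite J" and c: "\<And>i. bounded_linear (c i)"
    and der: "\<And>i y. i \<in> J \<Longrightarrow> y \<in> D \<Longrightarrow> ((\<lambda>t. f (y + t *\<^sub>R b i)) has_vector_derivative g i y) (at 0)"
    and cont: "\<And>i. i \<in> J \<Longrightarrow> continuous_on D (g i)"
  shows "\<forall>r>0. \<exists>d>0. \<forall>h. norm h < d \<longrightarrow>
     norm (f (x + (\<Sum>i\<in>J. c i h *\<^sub>R b i)) - f x - (\<Sum>i\<in>J. c i h *\<^sub>R g i x)) \<le> r * norm h"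
  using J der cont
proof (induction J)
  case empty
  show ?case by (auto intro: exI[of _ 1])
next
  case (insert j J)
  show ?case
  proof (intro allI impI)
    fix r :: real assume r: "r > 0"
    define p where "p h = (\<Sum>i\<in>J. c i h *\<^sub>R b i)" for h
    have bl: "bounded_linear p" "bounded_linear (\<lambda>h. c j h *\<^sub>R b j)"
      unfolding p_def using c
      by (auto intro!: bounded_linear_intros bounded_linear_sum bounded_linear_scaleR_const)
    obtain C where C: "C > 0" "\<And>h. norm (p h) \<le> norm h * C"
      using bounded_linear.pos_bounded[OF bl(1)] by auto
    obtain C' where C': "C' > 0" "\<And>h. norm (c j h *\<^sub>R b j) \<le> norm h * C'"
      using bounded_linear.pos_bounded[OF bl(2)] by auto
    obtain c0 where c0: "c0 > 0" "\<And>h. norm (c j h) \<le> norm h * c0"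
      using bounded_linear.pos_bounded[OF c] by auto
    \<comment> \<open>Chosen so that the segment of length at most \<open>c0 * norm h\<close>
      contributes half of the allowed error; the induction hypothesis contributes the other
      half.\<close>
    define r1 where "r1 = r / (2 * c0)"
    have r1: "r1 > 0" using r c0 by (simp add: r1_def)
    have "continuous (at x) (g j)"
      using insert.prems(2) D continuous_on_eq_continuous_at by blast
    then obtain d0 where d0: "d0 > 0" "\<And>y. dist y x < d0 \<Longrightarrow> dist (g j y) (g j x) < r1"
      using r1 unfolding continuous_at_eps_delta by meson
    obtain d1 where d1: "d1 > 0" "ball x d1 \<subseteq> D"
      using D openE by blast
    obtain d2 where d2: "d2 > 0" "\<And>h. norm h < d2 \<Longrightarrow>
        norm (f (x + p h) - f x - (\<Sum>i\<in>J. c i h *\<^sub>R g i x)) \<le> (r/2) * norm h"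
    proof -
      have "\<exists>d>0. \<forall>h. norm h < d \<longrightarrow>
          norm (f (x + p h) - f x - (\<Sum>i\<in>J. c i h *\<^sub>R g i x)) \<le> (r/2) * norm h"
        unfolding p_def using insert.IH[OF insert.prems] r half_gt_zero[OF r] by blast
      then show ?thesis using that by blast
    qed
    \<comment> \<open>\<open>C\<close> bounds the displacement by the earlier coordinates and
      \<open>C'\<close> the one by the new coordinate, so the whole segment stays inside
      \<open>D\<close> and where \<open>g j\<close> is within \<open>r1\<close> of
      \<open>g j x\<close>.\<close>
    define d where "d = min d2 (min d0 d1 / (C + C'))"
    have "d > 0" using d0 d1 d2 C C' by (auto simp: d_def)
    moreover have "norm (f (x + (\<Sum>i\<in>insert j J. c i h *\<^sub>R b i)) - f x
        - (\<Sum>i\<in>insert j J. c i h *\<^sub>R g i x)) \<le> r * norm h" if h: "norm h < d" for h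
    proof -
      have hd: "norm h * (C + C') < min d0 d1"
        using h C C' unfolding d_def by (simp add: pos_less_divide_eq)
      have near: "dist (x + p h + t *\<^sub>R b j) x < min d0 d1" if "t \<in> closed_segment 0 (c j h)" for t
      proof -
        have "\<bar>t\<bar> \<le> \<bar>c j h\<bar>" using that by (auto simp: closed_segment_eq_real_ivl split: if_splits)
        then have "norm (t *\<^sub>R b j) \<le> norm (c j h *\<^sub>R b j)" by (simp add: mult_right_mono)
        then have "norm (p h + t *\<^sub>R b j) \<le> norm h * C + norm h * C'"
          using C(2)[of h] C'(2)[of h] norm_triangle_ineq[of "p h" "t *\<^sub>R b j"] by linarith
        then show ?thesis using hd by (simp add: dist_norm algebra_simps)
      qed
      let ?S = "closed_segment 0 (c j h)"
      have "norm (f (x + p h + c j h *\<^sub>R b j) - f (x + p h + 0 *\<^sub>R b j) - (c j h - 0) *\<^sub>R g j x)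
          \<le> norm (c j h - 0) * r1"
      proof -
        have "norm (f (x + p h + c j h *\<^sub>R b j) - c j h *\<^sub>R g j x - (f (x + p h + 0 *\<^sub>R b j) - 0 *\<^sub>R g j x))
           \<le> r1 * norm (c j h - 0)"
        proof (rule differentiable_bound[of ?S "\<lambda>t. f (x + p h + t *\<^sub>R b j) - t *\<^sub>R g j x"
                "\<lambda>t s. s *\<^sub>R (g j (x + p h + t *\<^sub>R b j) - g j x)"])
          fix t assume t: "t \<in> ?S"
          have "x + p h + t *\<^sub>R b j \<in> D"
            using near[OF t] d1 by (auto simp: dist_commute)
          then have "((\<lambda>t. f (x + p h + t *\<^sub>R b j)) has_vector_derivative g j (x + p h + t *\<^sub>R b j)) (at t)"
            by (rule has_vector_derivative_line_shift[OF insert.prems(1)[OF insertI1]])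
          from has_derivative_at_withinI[OF this[unfolded has_vector_derivative_def]]
          show "((\<lambda>t. f (x + p h + t *\<^sub>R b j) - t *\<^sub>R g j x) has_derivative
              (\<lambda>s. s *\<^sub>R (g j (x + p h + t *\<^sub>R b j) - g j x))) (at t within ?S)"
            unfolding scaleR_diff_right
            by (intro has_derivative_diff has_derivative_scaleR_left has_derivative_ident)
          have "norm (g j (x + p h + t *\<^sub>R b j) - g j x) \<le> r1"
            using d0(2)[of "x + p h + t *\<^sub>R b j"] near[OF t] by (simp add: dist_norm)
          then show "onorm (\<lambda>s. s *\<^sub>R (g j (x + p h + t *\<^sub>R b j) - g j x)) \<le> r1"
            by (auto intro!: onorm_le mult_left_mono simp: mult.commute[of r1])
        qed simp_all
        then show ?thesis by (simp add: algebra_simps)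
      qed
      also have "\<dots> \<le> (norm h * c0) * r1"
        using c0(2)[of h] r1 by (simp add: mult_right_mono)
      also have "\<dots> = (r/2) * norm h" using c0 by (simp add: r1_def)
      finally have "norm (f (x + p h + c j h *\<^sub>R b j) - f (x + p h) - c j h *\<^sub>R g j x) \<le> (r/2) * norm h"
        by simp
      moreover have "norm (f (x + p h) - f x - (\<Sum>i\<in>J. c i h *\<^sub>R g i x)) \<le> (r/2) * norm h"
        using d2 h by (simp add: d_def)
      moreover have "f (x + (\<Sum>i\<in>insert j J. c i h *\<^sub>R b i)) - f x - (\<Sum>i\<in>insert j J. c i h *\<^sub>R g i x)
         = (f (x + p h + c j h *\<^sub>R b j) - f (x + p h) - c j h *\<^sub>R g j x)
         + (f (x + p h) - f x - (\<Sum>i\<in>J. c i h *\<^sub>R g i x))"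
        using insert.hyps by (simp add: p_def algebra_simps)
      ultimately show ?thesis
        by (simp only:) (intro norm_triangle_le, linarith)
    qed
    ultimately show "\<exists>d>0. \<forall>h. norm h < d \<longrightarrow> norm (f (x + (\<Sum>i\<in>insert j J. c i h *\<^sub>R b i)) - f x
        - (\<Sum>i\<in>insert j J. c i h *\<^sub>R g i x)) \<le> r * norm h"
      by blast
  qed
qed

lemma has_derivative_partials:
  fixes f :: "'a::real_normed_vector \<Rightarrow> 'b::real_normed_vector" and b :: "'i \<Rightarrow> 'a"
  assumes "open D" "x \<in> D" and "finite J" and c: "\<And>i. bounded_linear (c i)"
    and expand: "\<And>h. (\<Sum>i\<in>J. c i h *\<^sub>R b i) = h"
    and "\<And>i y. i \<in> J \<Longrightarrow> y \<in> D \<Longrightarrow> ((\<lambda>t. f (y + t *\<^sub>R b i)) has_vector_derivative g i y) (at 0)"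
    and "\<And>i. i \<in> J \<Longrightarrow> continuous_on D (g i)"
  shows "(f has_derivative (\<lambda>h. \<Sum>i\<in>J. c i h *\<^sub>R g i x)) (at x)"
  unfolding has_derivative_at_alt
proof
  show "bounded_linear (\<lambda>h. \<Sum>i\<in>J. c i h *\<^sub>R g i x)"
    using c by (auto intro!: bounded_linear_sum bounded_linear_scaleR_const)
  have "\<forall>r>0. \<exists>d>0. \<forall>h. norm h < d \<longrightarrow> norm (f (x + h) - f x - (\<Sum>i\<in>J. c i h *\<^sub>R g i x)) \<le> r * norm h"
    using partial_increment[of D x J c f b g] assms by simp
  then have "\<forall>r>0. \<exists>d>0. \<forall>y. norm (y - x) < d \<longrightarrow>
      norm (f (x + (y - x)) - f x - (\<Sum>i\<in>J. c i (y - x) *\<^sub>R g i x)) \<le> r * norm (y - x)"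
    by blast
  then show "\<forall>e>0. \<exists>d>0. \<forall>y. norm (y - x) < d \<longrightarrow>
       norm (f y - f x - (\<Sum>i\<in>J. c i (y - x) *\<^sub>R g i x)) \<le> e * norm (y - x)"
    by simp
qed

text \<open>Continuity is asked of each directional derivative separately, which avoids functions
  with values in a space of linear maps; on a finite-dimensional domain it amounts to continuity of
  the total derivative.\<close>

definition C1_on :: "'a::real_normed_vector set \<Rightarrow> ('a \<Rightarrow> 'b::real_normed_vector) \<Rightarrow> bool" where
  "C1_on D f \<longleftrightarrow> open D \<and> (\<forall>x\<in>D. f differentiable (at x)) \<and> (\<forall>u. continuous_on D (dir_deriv u f))"

text \<open>The expanding family is left general because two are used: the standard basis for
  mollified functions and the completed basis \<open>v\<close> for functions extended from
  \<open>M\<close>.\<close>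

lemma C1_on_partials:
  fixes f :: "'a::real_normed_vector \<Rightarrow> 'b::real_normed_vector" and b :: "'i \<Rightarrow> 'a"
  assumes D: "open D" and J: "finite J" and c: "\<And>i. bounded_linear (c i)"
    and expand: "\<And>h. (\<Sum>i\<in>J. c i h *\<^sub>R b i) = h"
    and der: "\<And>i y. i \<in> J \<Longrightarrow> y \<in> D \<Longrightarrow> ((\<lambda>t. f (y + t *\<^sub>R b i)) has_vector_derivative g i y) (at 0)"
    and cont: "\<And>i. i \<in> J \<Longrightarrow> continuous_on D (g i)"
  shows "C1_on D f" "\<And>u x. x \<in> D \<Longrightarrow> dir_deriv u f x = (\<Sum>i\<in>J. c i u *\<^sub>R g i x)"
proof -
  have d: "(f has_derivative (\<lambda>h. \<Sum>i\<in>J. c i h *\<^sub>R g i x)) (at x)" if "x \<in> D" for x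
    using has_derivative_partials[OF D that J c expand der cont] .
  show e: "\<And>u x. x \<in> D \<Longrightarrow> dir_deriv u f x = (\<Sum>i\<in>J. c i u *\<^sub>R g i x)"
    using dir_deriv_eq[OF d] .
  have "continuous_on D (dir_deriv u f)" for u
  proof -
    have "continuous_on D (\<lambda>x. \<Sum>i\<in>J. c i u *\<^sub>R g i x)"
      by (intro continuous_intros cont)
    then show ?thesis using e by (simp cong: continuous_on_cong)
  qed
  then show "C1_on D f" using D d unfolding C1_on_def differentiable_def by blast
qed

lemma C1_on_continuous: "C1_on D f \<Longrightarrow> continuous_on D f"
  by (simp add: C1_on_def differentiable_at_withinI differentiable_on_def
      differentiable_imp_continuous_on)

lemma dir_deriv_affine:
  assumes "f differentiable (at (p + r *\<^sub>R x))"
  shows "(\<lambda>y. f (p + r *\<^sub>R y)) differentiable (at x)"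
    "dir_deriv u (\<lambda>y. f (p + r *\<^sub>R y)) x = r *\<^sub>R dir_deriv u f (p + r *\<^sub>R x)"
proof -
  note d = differentiable_dir_deriv[OF assms]
  have "(f \<circ> (\<lambda>y. p + r *\<^sub>R y) has_derivative (\<lambda>u. dir_deriv u f (p + r *\<^sub>R x)) \<circ> (\<lambda>y. r *\<^sub>R y)) (at x)"
    by (rule diff_chain_at) (auto intro!: derivative_eq_intros d)
  then have *: "((\<lambda>y. f (p + r *\<^sub>R y)) has_derivative (\<lambda>u. r *\<^sub>R dir_deriv u f (p + r *\<^sub>R x))) (at x)"
    using linear_cmul[OF has_derivative_linear[OF d]] by (simp add: o_def)
  then show "(\<lambda>y. f (p + r *\<^sub>R y)) differentiable (at x)"
    by (auto simp: differentiable_def)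
  show "dir_deriv u (\<lambda>y. f (p + r *\<^sub>R y)) x = r *\<^sub>R dir_deriv u f (p + r *\<^sub>R x)"
    using dir_deriv_eq[OF *] .
qed

lemma open_affine_vimage:
  "open D \<Longrightarrow> open {y::'a::real_normed_vector. p + r *\<^sub>R y \<in> D}"
  using open_vimage[of D "\<lambda>y. p + r *\<^sub>R y"]
  by (simp add: vimage_def continuous_intros)

lemma C1_on_affine:
  assumes "C1_on D f"
  shows "C1_on {y. p + r *\<^sub>R y \<in> D} (\<lambda>y. f (p + r *\<^sub>R y))"
  unfolding C1_on_def
proof (intro conjI ballI allI)
  show "open {y. p + r *\<^sub>R y \<in> D}" using assms by (simp add: C1_on_def open_affine_vimage)
  show "(\<lambda>y. f (p + r *\<^sub>R y)) differentiable (at x)" if "x \<in> {y. p + r *\<^sub>R y \<in> D}" for x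
    using assms that by (auto simp: C1_on_def intro!: dir_deriv_affine)
  fix u
  have "continuous_on D (dir_deriv u f)" using assms by (simp add: C1_on_def)
  then have "continuous_on {y. p + r *\<^sub>R y \<in> D} (\<lambda>y. r *\<^sub>R dir_deriv u f (p + r *\<^sub>R y))"
    by (auto intro!: continuous_intros intro: continuous_on_compose2)
  then show "continuous_on {y. p + r *\<^sub>R y \<in> D} (dir_deriv u (\<lambda>y. f (p + r *\<^sub>R y)))"
    by (rule continuous_on_eq) (use assms in \<open>auto simp: C1_on_def dir_deriv_affine\<close>)
qed

section \<open>A radial bump function\<close>

lemma cball_subset_cbox: "cball 0 r \<subseteq> cbox (- (r *\<^sub>R One)) (r *\<^sub>R One :: 'a::euclidean_space)"
proof
  fix x :: 'a assume "x \<in> cball 0 r"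
  then have "\<bar>x \<bullet> i\<bar> \<le> r" if "i \<in> Basis" for i
    using Basis_le_norm[OF that, of x] by simp
  then show "x \<in> cbox (- (r *\<^sub>R One)) (r *\<^sub>R One)"
    by (auto simp: mem_box abs_le_iff minus_le_iff)
qed

lemma cbox_subset_cball:
  "cbox (- (r *\<^sub>R One)) (r *\<^sub>R One :: 'a::euclidean_space) \<subseteq> cball 0 (r * DIM('a))"
proof
  fix x :: 'a assume x: "x \<in> cbox (- (r *\<^sub>R One)) (r *\<^sub>R One)"
  have "norm x \<le> (\<Sum>i\<in>Basis. \<bar>x \<bullet> i\<bar>)" by (rule norm_le_l1)
  also have "\<dots> \<le> (\<Sum>i\<in>(Basis::'a set). r)"
    using x by (intro sum_mono) (auto simp: mem_box abs_le_iff minus_le_iff)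
  finally show "x \<in> cball 0 (r * DIM('a))" by (simp add: mult.commute)
qed

section \<open>Integrals of compactly supported functions and their derivatives\<close>

lemma integral_UNIV_eq:
  fixes f :: "'a::euclidean_space \<Rightarrow> 'b::banach"
  assumes "\<And>y. y \<notin> S \<Longrightarrow> f y = 0"
  shows "integral UNIV f = integral S f"
proof -
  have "(\<lambda>x. if x \<in> S then f x else 0) = f" using assms by auto
  then show ?thesis using integral_restrict_UNIV[of S f] by simp
qed

lemma integrable_UNIV_compact_support:
  fixes f :: "'a::euclidean_space \<Rightarrow> 'b::banach"
  assumes "continuous_on UNIV f" "\<And>y. norm y > r \<Longrightarrow> f y = 0"
  shows "f integrable_on UNIV"
proof -
  have "f integrable_on cbox (- (r *\<^sub>R One)) (r *\<^sub>R One)"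
    using assms(1) continuous_on_subset integrable_continuous by blast
  then show ?thesis
    using assms(2) cball_subset_cbox[of r, where 'a='a]
    by (elim integrable_on_superset) (auto simp: subset_eq not_le)
qed

lemma integral_UNIV_shift:
  fixes f :: "'a::euclidean_space \<Rightarrow> 'b::banach"
  assumes "\<And>y. norm y > r \<Longrightarrow> f y = 0"
  shows "integral UNIV (\<lambda>y. f (y + c)) = integral UNIV f"
proof -
  let ?a = "- (r *\<^sub>R One) :: 'a" and ?b = "r *\<^sub>R One :: 'a"
  have z: "f y = 0" if "y \<notin> cbox ?a ?b" for y
    using that assms[of y] cball_subset_cbox[of r, where 'a='a] by (auto simp: subset_eq not_le)
  have "integral UNIV (\<lambda>y. f (y + c)) = integral (cbox (?a - c) (?b - c)) (\<lambda>y. f (y + c))"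
  proof (rule integral_UNIV_eq)
    fix y assume "y \<notin> cbox (?a - c) (?b - c)"
    then have "y + c \<notin> cbox ?a ?b"
      by (auto simp: mem_box algebra_simps inner_left_distrib)
    then show "f (y + c) = 0" by (rule z)
  qed
  also have "\<dots> = integral (cbox ?a ?b) f" by (rule integral_shift_cbox)
  also have "\<dots> = integral UNIV f" by (rule integral_UNIV_eq[symmetric]) (rule z)
  finally show ?thesis .
qed

text \<open>\<open>F\<close> may be arbitrary off \<open>D\<close>: the open sets \<open>D\<close>
  and the complement of the closed unit ball cover the space, and on the second one the product is
  zero.\<close>

lemma continuous_on_scaleR_support:
  fixes F :: "'a::real_normed_vector \<Rightarrow> 'b::real_normed_vector"
  assumes "open D" "cball 0 1 \<subseteq> D" "continuous_on D F" "continuous_on UNIV k"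
    and "\<And>y. norm y > 1 \<Longrightarrow> k y = 0"
  shows "continuous_on UNIV (\<lambda>y. k y *\<^sub>R F y)"
proof -
  have "continuous_on (D \<union> - cball 0 1) (\<lambda>y. k y *\<^sub>R F y)"
  proof (rule continuous_on_open_Un)
    show "continuous_on D (\<lambda>y. k y *\<^sub>R F y)"
      using assms by (intro continuous_intros) (auto intro: continuous_on_subset)
    have "continuous_on (- cball 0 1) (\<lambda>y. 0 :: 'b)" by simp
    then show "continuous_on (- cball 0 1) (\<lambda>y. k y *\<^sub>R F y)"
      by (rule continuous_on_eq) (auto simp: assms)
  qed (use assms in auto)
  moreover have "D \<union> - cball 0 1 = UNIV" using assms(2) by auto
  ultimately show ?thesis by simp
qed

lemma dir_deriv_zero_open:
  assumes "open T" "x \<in> T" "\<And>y. y \<in> T \<Longrightarrow> f y = 0"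
  shows "(f has_derivative (\<lambda>_. 0)) (at x)" "dir_deriv u f x = 0"
proof -
  show "(f has_derivative (\<lambda>_. 0)) (at x)"
    by (rule has_derivative_transform_within_open[of "\<lambda>_. 0" _ x UNIV T]) (use assms in auto)
  then show "dir_deriv u f x = 0" by (simp add: dir_deriv_eq)
qed

lemma open_norm_gt: "open {y::'a::real_normed_vector. norm y > r}"
  by (intro open_Collect_less continuous_intros)

text \<open>By translation invariance the integral of \<open>K (y + t *\<^sub>R u)\<close> does not
  depend on \<open>t\<close>; differentiating under the integral sign at \<open>t = 0\<close> gives
  the claim.\<close>

lemma integral_dir_deriv_zero:
  fixes K :: "'a::euclidean_space \<Rightarrow> 'b::banach"
  assumes diff: "\<And>y. K differentiable (at y)" and cont: "continuous_on UNIV (dir_deriv u K)"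
    and supp: "\<And>y. norm y > 1 \<Longrightarrow> K y = 0"
  shows "integral UNIV (dir_deriv u K) = 0"
proof -
  \<comment> \<open>For \<open>\<bar>t\<bar> \<le> 1\<close> every translate of the unit ball by
    \<open>t *\<^sub>R u\<close> stays in radius \<open>1 + norm u\<close>, so one box serves all
    parameters.\<close>
  define r where "r = 1 + norm u"
  let ?B = "cbox (- (r *\<^sub>R One)) (r *\<^sub>R One) :: 'a set"
  have out: "norm y > r" if "y \<notin> ?B" for y
    using that cball_subset_cbox[of r, where 'a='a] by (auto simp: subset_eq not_le)
  have contK: "continuous_on UNIV K"
    using diff differentiable_imp_continuous_within by (auto simp: continuous_on_eq_continuous_at)
  have const: "integral ?B (\<lambda>y. K (y + t *\<^sub>R u)) = integral UNIV K" if "t \<in> {-1..1}" for t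
  proof -
    have "integral UNIV (\<lambda>y. K (y + t *\<^sub>R u)) = integral ?B (\<lambda>y. K (y + t *\<^sub>R u))"
    proof (intro integral_UNIV_eq supp)
      fix y assume "y \<notin> ?B"
      then have "norm y > 1 + norm u" using out r_def by blast
      moreover have "norm (t *\<^sub>R u) \<le> norm u" using that by (simp add: mult_left_le_one_le abs_le_iff)
      moreover have "norm y \<le> norm (y + t *\<^sub>R u) + norm (t *\<^sub>R u)"
        using norm_triangle_ineq4[of "y + t *\<^sub>R u" "t *\<^sub>R u"] by simp
      ultimately show "norm (y + t *\<^sub>R u) > 1" by linarith
    qed
    moreover have "integral UNIV (\<lambda>y. K (y + t *\<^sub>R u)) = integral UNIV K"
      by (rule integral_UNIV_shift) (rule supp)
    ultimately show ?thesis by simp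
  qed
  have "((\<lambda>t. integral ?B (\<lambda>y. K (y + t *\<^sub>R u))) has_vector_derivative
      integral ?B (\<lambda>y. dir_deriv u K (y + 0 *\<^sub>R u))) (at 0 within {-1..1})"
  proof (rule leibniz_rule_vector_derivative)
    show "((\<lambda>t. K (y + t *\<^sub>R u)) has_vector_derivative dir_deriv u K (y + t *\<^sub>R u)) (at t within {-1..1})"
      for t y using diff by (rule has_vector_derivative_line)
    show "(\<lambda>y. K (y + t *\<^sub>R u)) integrable_on ?B" for t
      by (intro integrable_continuous continuous_on_compose2[OF contK] continuous_intros) auto
    show "continuous_on ({-1..1} \<times> ?B) (\<lambda>(t, y). dir_deriv u K (y + t *\<^sub>R u))"
      unfolding split_beta
      by (intro continuous_on_compose2[OF cont] continuous_intros) auto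
  qed auto
  then have "((\<lambda>t. integral UNIV K) has_vector_derivative integral ?B (\<lambda>y. dir_deriv u K (y + 0 *\<^sub>R u)))
      (at 0 within {-1..1})"
    by (rule has_vector_derivative_transform[rotated 2]) (use const in auto)
  then have "((\<lambda>t. integral UNIV K) has_vector_derivative integral ?B (dir_deriv u K)) (at 0 within {-1..1})"
    by simp
  moreover have "at (0::real) within {-1..1} = at 0" by (rule at_within_Icc_at) auto
  ultimately have "integral ?B (dir_deriv u K) = 0"
    by (metis vector_derivative_unique_at[OF has_vector_derivative_const])
  moreover have "dir_deriv u K y = 0" if "y \<notin> ?B" for y
  proof (rule dir_deriv_zero_open(2)[OF open_norm_gt[of 1]])
    show "y \<in> {y. 1 < norm y}" using out[OF that] norm_ge_zero[of u] unfolding r_def mem_Collect_eq by linarith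
  qed (use supp in auto)
  ultimately show ?thesis by (subst integral_UNIV_eq[of ?B]) auto
qed

text \<open>The square makes the cut-off C^1 across the unit sphere. Its gradient at
  \<open>y\<close> is a multiple of \<open>y\<close>, and this is what cancels the weight's
  derivative in rotation fields.\<close>

definition bump :: "'a::real_inner \<Rightarrow> real" where
  "bump y = (max 0 (1 - y \<bullet> y))\<^sup>2"

definition bump_deriv :: "'a::real_inner \<Rightarrow> 'a \<Rightarrow> real" where
  "bump_deriv u y = - 4 * max 0 (1 - y \<bullet> y) * (y \<bullet> u)"

lemma max_sq_deriv: "((\<lambda>t::real. (max 0 t)\<^sup>2) has_real_derivative 2 * max 0 t) (at t)"
proof (cases t "0::real" rule: linorder_cases)
  case less
  have "((\<lambda>t::real. 0) has_real_derivative 0) (at t)" by simp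
  then have "((\<lambda>t::real. (max 0 t)\<^sup>2) has_real_derivative 0) (at t)"
    by (rule has_field_derivative_transform_within_open[of _ _ _ "{..<0}"]) (use less in auto)
  then show ?thesis using less by simp
next
  case greater
  have "((\<lambda>t::real. t\<^sup>2) has_real_derivative 2 * t) (at t)" by (auto intro!: derivative_eq_intros)
  then have "((\<lambda>t::real. (max 0 t)\<^sup>2) has_real_derivative 2 * t) (at t)"
    by (rule has_field_derivative_transform_within_open[of _ _ _ "{0<..}"]) (use greater in auto)
  then show ?thesis using greater by simp
next
  case equal
  have "((\<lambda>h. (max 0 h)\<^sup>2 / h) \<longlongrightarrow> (0::real)) (at 0)"
  proof (rule Lim_null_comparison)
    show "\<forall>\<^sub>F h in at 0. norm ((max 0 h)\<^sup>2 / h) \<le> \<bar>h\<bar>"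
      by (intro always_eventually allI) (auto simp: max_def power2_eq_square)
    show "((\<lambda>h::real. \<bar>h\<bar>) \<longlongrightarrow> 0) (at 0)" by (intro tendsto_rabs_zero tendsto_ident_at)
  qed
  then show ?thesis using equal by (simp add: DERIV_def)
qed

lemma bump_has_derivative: "(bump has_derivative (\<lambda>u. bump_deriv u y)) (at y)"
proof -
  have "((\<lambda>t. (max 0 t)\<^sup>2) \<circ> (\<lambda>y::'a. 1 - y \<bullet> y) has_derivative
      (*) (2 * max 0 (1 - y \<bullet> y)) \<circ> (\<lambda>u. - (2 * (y \<bullet> u)))) (at y)"
  proof (rule diff_chain_at)
    show "((\<lambda>y. 1 - y \<bullet> y) has_derivative (\<lambda>u. - (2 * (y \<bullet> u)))) (at y)"
      by (auto intro!: derivative_eq_intros simp: inner_commute)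
    show "((\<lambda>t. (max 0 t)\<^sup>2) has_derivative (*) (2 * max 0 (1 - y \<bullet> y))) (at (1 - y \<bullet> y))"
      using max_sq_deriv[of "1 - y \<bullet> y"] by (simp add: has_field_derivative_def)
  qed
  moreover have "(\<lambda>t. (max 0 t)\<^sup>2) \<circ> (\<lambda>y::'a. 1 - y \<bullet> y) = bump" by (auto simp: bump_def)
  moreover have "(*) (2 * max 0 (1 - y \<bullet> y)) \<circ> (\<lambda>u. - (2 * (y \<bullet> u))) = (\<lambda>u. bump_deriv u y)"
    by (auto simp: bump_deriv_def)
  ultimately show ?thesis by simp
qed

lemma sq_norm_ge_1: "norm y \<ge> 1 \<Longrightarrow> y \<bullet> y \<ge> 1" for y :: "'a::real_inner"
  by (simp add: dot_square_norm)

lemma bump_outside: "norm y \<ge> 1 \<Longrightarrow> bump y = 0" "norm y \<ge> 1 \<Longrightarrow> bump_deriv u y = 0"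
  using sq_norm_ge_1[of y] by (auto simp: bump_def bump_deriv_def)

lemma continuous_on_bump [continuous_intros]:
  "continuous_on S f \<Longrightarrow> continuous_on S (\<lambda>x. bump (f x))"
  "continuous_on S f \<Longrightarrow> continuous_on S (\<lambda>x. bump_deriv u (f x))"
  unfolding bump_def bump_deriv_def by (intro continuous_intros; assumption)+

lemma bump_nonneg: "bump y \<ge> 0" by (simp add: bump_def)

lemma abs_bump_deriv_le: "\<bar>bump_deriv u y\<bar> \<le> 4 * norm u"
proof (cases "norm y \<ge> 1")
  case True then show ?thesis by (simp add: bump_outside)
next
  case False
  have "\<bar>max 0 (1 - y \<bullet> y)\<bar> \<le> 1" by (auto simp: max_def)
  moreover have "\<bar>y \<bullet> u\<bar> \<le> norm u"
    using Cauchy_Schwarz_ineq2[of y u] False mult_left_le_one_le[of "norm u" "norm y"] by simp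
  ultimately have "\<bar>max 0 (1 - y \<bullet> y)\<bar> * \<bar>y \<bullet> u\<bar> \<le> 1 * norm u"
    by (intro mult_mono) auto
  then show ?thesis by (simp add: bump_deriv_def abs_mult)
qed

lemma integral_bump_pos: "integral UNIV (bump :: 'a::euclidean_space \<Rightarrow> real) > 0"
proof -
  let ?B = "cbox (- (1 *\<^sub>R One)) (1 *\<^sub>R One) :: 'a set"
  have cont: "continuous_on ?B bump" using continuous_on_bump(1)[OF continuous_on_id, of ?B] by simp
  have "integral UNIV (bump :: 'a \<Rightarrow> real) = integral ?B bump"
  proof (intro integral_UNIV_eq bump_outside)
    show "1 \<le> norm y" if "y \<notin> ?B" for y
      using that cball_subset_cbox[of 1, where 'a='a] by (auto simp: subset_eq)
  qed
  moreover have "integral ?B bump \<ge> 0"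
    by (intro integral_nonneg integrable_continuous cont) (simp add: bump_nonneg)
  moreover have "integral ?B bump \<noteq> 0"
  proof
    assume "integral ?B bump = 0"
    then have "\<forall>x\<in>?B. bump x = 0"
      by (subst (asm) integral_cbox_eq_0_iff[OF cont]) (auto simp: box_ne_empty bump_nonneg)
    moreover have "(0::'a) \<in> ?B" using cball_subset_cbox[of 1, where 'a='a] by auto
    ultimately show False by (auto simp: bump_def)
  qed
  ultimately show ?thesis by simp
qed

text \<open>By the product rule the integrand is the derivative along \<open>b\<close> of the
  compactly supported function \<open>K\<close>.\<close>

lemma integral_bump_by_parts:
  fixes G :: "'a::euclidean_space \<Rightarrow> 'b::banach"
  assumes G: "C1_on D G" and D: "cball 0 1 \<subseteq> D"
  shows "integral UNIV (\<lambda>y. (bump_deriv b y * (y \<bullet> a) + bump y * (b \<bullet> a)) *\<^sub>R G y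
      + (bump y * (y \<bullet> a)) *\<^sub>R dir_deriv b G y) = 0"
proof -
  define K where "K y = (bump y * (y \<bullet> a)) *\<^sub>R G y" for y
  have oD: "open D" and dG: "\<And>y. y \<in> D \<Longrightarrow> (G has_derivative (\<lambda>u. dir_deriv u G y)) (at y)"
    using G differentiable_dir_deriv by (auto simp: C1_on_def)
  have K: "K differentiable (at y) \<and> dir_deriv b K y =
      (bump_deriv b y * (y \<bullet> a) + bump y * (b \<bullet> a)) *\<^sub>R G y + (bump y * (y \<bullet> a)) *\<^sub>R dir_deriv b G y" for y
  proof (cases "y \<in> D")
    case True
    have "(K has_derivative (\<lambda>u. (bump y * (y \<bullet> a)) *\<^sub>R dir_deriv u G y
        + (bump y * (u \<bullet> a) + bump_deriv u y * (y \<bullet> a)) *\<^sub>R G y)) (at y)"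
      unfolding K_def
      by (intro has_derivative_scaleR has_derivative_mult bump_has_derivative dG True
          has_derivative_inner_left has_derivative_ident)
    then show ?thesis
      by (auto simp: differentiable_def dir_deriv_eq add.commute)
  next
    \<comment> \<open>Off \<open>D\<close> nothing is known about \<open>G\<close>, but
      \<open>y\<close> then lies in the open set outside the closed unit ball, where
      \<open>K\<close> is identically zero.\<close>
    case False
    then have y: "y \<in> {y. norm y > 1}" using D by (auto simp: subset_eq)
    have "K z = 0" if "z \<in> {y. norm y > 1}" for z
      using that by (simp add: K_def bump_outside)
    with dir_deriv_zero_open[OF open_norm_gt y, of K] have
      "(K has_derivative (\<lambda>_. 0)) (at y)" "dir_deriv b K y = 0" by blast+
    then show ?thesis using y unfolding differentiable_def by (auto simp: bump_outside)
  qed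
  have "continuous_on UNIV (\<lambda>y. (bump_deriv b y * (y \<bullet> a) + bump y * (b \<bullet> a)) *\<^sub>R G y
      + (bump y * (y \<bullet> a)) *\<^sub>R dir_deriv b G y)"
    by (intro continuous_on_add continuous_on_scaleR_support[OF oD D] C1_on_continuous[OF G]
        continuous_intros)
      (use G in \<open>auto simp: C1_on_def bump_outside\<close>)
  moreover have dK: "dir_deriv b K = (\<lambda>y. (bump_deriv b y * (y \<bullet> a) + bump y * (b \<bullet> a)) *\<^sub>R G y
      + (bump y * (y \<bullet> a)) *\<^sub>R dir_deriv b G y)"
    using K by blast
  ultimately have "integral UNIV (dir_deriv b K) = 0"
    using K by (intro integral_dir_deriv_zero) (auto simp: K_def bump_outside)
  then show ?thesis by (simp add: dK)
qed

text \<open>Antisymmetrising the integration by parts in \<open>a\<close> and \<open>b\<close>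
  leaves the rotation field in their plane: the two terms with the derivative of the weight cancel
  because its gradient points along \<open>y\<close>.\<close>

lemma integral_bump_rotation:
  fixes G :: "'a::euclidean_space \<Rightarrow> 'b::banach"
  assumes G: "C1_on D G" and D: "cball 0 1 \<subseteq> D" and ab: "a \<bullet> b = 0"
  shows "((\<lambda>y. bump y *\<^sub>R ((y \<bullet> a) *\<^sub>R dir_deriv b G y - (y \<bullet> b) *\<^sub>R dir_deriv a G y)) has_integral 0) UNIV"
proof -
  have oD: "open D" using G by (simp add: C1_on_def)
  define I where "I a b = (\<lambda>y. (bump_deriv b y * (y \<bullet> a) + bump y * (b \<bullet> a)) *\<^sub>R G y
      + (bump y * (y \<bullet> a)) *\<^sub>R dir_deriv b G y)" for a b
  have "(I a b has_integral 0) UNIV" for a b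
  proof -
    have "continuous_on UNIV (I a b)" unfolding I_def
      by (intro continuous_on_add continuous_on_scaleR_support[OF oD D] C1_on_continuous[OF G]
          continuous_intros)
        (use G in \<open>auto simp: C1_on_def bump_outside\<close>)
    then have "I a b integrable_on UNIV"
      by (rule integrable_UNIV_compact_support[where r=1]) (simp add: I_def bump_outside)
    then show ?thesis
      using integral_bump_by_parts[OF G D, of b a] by (simp add: has_integral_iff I_def)
  qed
  from has_integral_diff[OF this this, of a b b a]
  have "((\<lambda>y. I a b y - I b a y) has_integral 0) UNIV" by simp
  moreover have "I a b y - I b a y =
      bump y *\<^sub>R ((y \<bullet> a) *\<^sub>R dir_deriv b G y - (y \<bullet> b) *\<^sub>R dir_deriv a G y)" for y
    using ab by (simp add: I_def bump_deriv_def inner_commute algebra_simps)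
  ultimately show ?thesis by simp
qed

section \<open>Mollification and the mean value property\<close>

definition mollify :: "('a::euclidean_space \<Rightarrow> real) \<Rightarrow> ('a \<Rightarrow> 'b::banach) \<Rightarrow> 'a \<Rightarrow> 'b" where
  "mollify k F p = integral UNIV (\<lambda>z. k (z - p) *\<^sub>R F z)"

text \<open>The substitution \<open>y = z - p\<close> moves the parameter from the kernel to the
  function. The defining form is the one to differentiate on the kernel, this one on
  \<open>F\<close>.\<close>

lemma mollify_shift:
  assumes "\<And>y. norm y > 1 \<Longrightarrow> k y = 0"
  shows "mollify k F p = integral UNIV (\<lambda>y. k y *\<^sub>R F (p + y))"
proof -
  have "integral UNIV (\<lambda>y. k (y + - p) *\<^sub>R F (p + (y + - p))) = integral UNIV (\<lambda>y. k y *\<^sub>R F (p + y))"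
    by (rule integral_UNIV_shift[where r = 1]) (simp add: assms)
  then show ?thesis by (simp add: mollify_def)
qed

abbreviation box2 :: "'a::euclidean_space set" where
  "box2 \<equiv> cbox (- (2 *\<^sub>R One)) (2 *\<^sub>R One)"

abbreviation box1 :: "'a::euclidean_space set" where
  "box1 \<equiv> cbox (- (1 *\<^sub>R One)) (1 *\<^sub>R One)"

lemma translate_box1:
  assumes "norm p \<le> 1" "y \<in> box1"
  shows "p + y \<in> box2"
proof -
  have "p \<in> box1" using assms(1) cball_subset_cbox[of 1] by auto
  with assms(2) show ?thesis by (force simp: mem_box inner_add_left)
qed

text \<open>\<open>box2\<close> contains the unit ball around every \<open>p\<close> of norm at most
  1, so the domain of integration no longer depends on \<open>p\<close> and parameter integrals can
  be treated by the Leibniz rule.\<close>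

lemma mollify_box:
  assumes "\<And>y. norm y > 1 \<Longrightarrow> k y = 0" and p: "norm p \<le> 1"
  shows "mollify k F p = integral box2 (\<lambda>z. k (z - p) *\<^sub>R F z)"
  unfolding mollify_def
proof (rule integral_UNIV_eq)
  fix z :: 'a assume "z \<notin> box2"
  then have "norm z > 2" using cball_subset_cbox[of 2, where 'a='a] by (auto simp: subset_eq not_le)
  then have "norm (z - p) > 1" using p norm_triangle_ineq2[of z p] by linarith
  then show "k (z - p) *\<^sub>R F z = 0" by (simp add: assms)
qed

lemma continuous_on_mollify:
  fixes F :: "'a::euclidean_space \<Rightarrow> 'b::banach"
  assumes F: "continuous_on box2 F" and k: "continuous_on UNIV k" and supp: "\<And>y. norm y > 1 \<Longrightarrow> k y = 0"
  shows "continuous_on (cball 0 1) (mollify k F)"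
proof -
  have "continuous_on (cball 0 1) (\<lambda>p. integral box2 (\<lambda>z. k (z - p) *\<^sub>R F z))"
  proof (rule integral_continuous_on_param)
    show "continuous_on (cball 0 1 \<times> box2) (\<lambda>(p, z). k (z - p) *\<^sub>R F z)"
      unfolding split_beta
      by (intro continuous_intros continuous_on_compose2[OF k] continuous_on_compose2[OF F]) auto
  qed
  then show ?thesis
    by (rule continuous_on_eq) (simp add: mollify_box[OF supp])
qed

lemma norm_mollify_le:
  fixes F :: "'a::euclidean_space \<Rightarrow> 'b::banach"
  assumes F: "continuous_on box2 F" and k: "continuous_on UNIV k" and supp: "\<And>y. norm y > 1 \<Longrightarrow> k y = 0"
    and p: "norm p \<le> 1" and A: "\<And>y. \<bar>k y\<bar> \<le> A" and K: "\<And>z. z \<in> box2 \<Longrightarrow> norm (F z) \<le> K"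
  shows "norm (mollify k F p) \<le> A * K * measure lborel (box2 :: 'a set)"
proof (rule has_integral_bound)
  have "(\<lambda>z. k (z - p) *\<^sub>R F z) integrable_on box2"
    by (intro integrable_continuous continuous_intros continuous_on_compose2[OF k] F) auto
  then show "((\<lambda>z. k (z - p) *\<^sub>R F z) has_integral mollify k F p) box2"
    by (simp add: mollify_box[OF supp p] has_integral_integral)
  have "0 \<in> (box2 :: 'a set)" using cball_subset_cbox[of 2, where 'a='a] by auto
  then have "0 \<le> K" using K norm_ge_zero order_trans by blast
  moreover have "0 \<le> A" using A[of 0] by linarith
  ultimately show "0 \<le> A * K" by simp
  show "norm (k (z - p) *\<^sub>R F z) \<le> A * K" if "z \<in> box2" for z
    using A[of "z - p"] K[OF that] \<open>0 \<le> A\<close> by (simp add: mult_mono)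
qed

lemma open_line_ball: "open {t::real. norm (p + t *\<^sub>R u) < r}"
  by (intro open_Collect_less continuous_intros)

text \<open>The derivative falls on the kernel, so continuity of \<open>F\<close> suffices; the sign
  comes from the argument \<open>z - p\<close>.\<close>

lemma mollify_bump_derivative:
  fixes F :: "'a::euclidean_space \<Rightarrow> 'b::banach"
  assumes F: "continuous_on box2 F" and p: "norm p < 1"
  shows "((\<lambda>t. mollify bump F (p + t *\<^sub>R u)) has_vector_derivative - mollify (bump_deriv u) F p) (at 0)"
proof -
  have contb: "continuous_on UNIV (bump :: 'a \<Rightarrow> real)" "continuous_on UNIV (bump_deriv u)"
    using continuous_on_bump[OF continuous_on_id, of UNIV] by auto
  have "((\<lambda>t. integral box2 (\<lambda>z. bump (z - (p + t *\<^sub>R u)) *\<^sub>R F z)) has_vector_derivative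
      integral box2 (\<lambda>z. - bump_deriv u (z - (p + 0 *\<^sub>R u)) *\<^sub>R F z)) (at 0)"
  proof (rule leibniz_rule_vector_derivative)
    fix t :: real and z
    have "((\<lambda>t. bump (z - p + t *\<^sub>R (- u))) has_vector_derivative
        dir_deriv (- u) bump (z - p + t *\<^sub>R (- u))) (at t)"
      using bump_has_derivative by (intro has_vector_derivative_line) (auto simp: differentiable_def)
    then have "((\<lambda>t. bump (z - p + t *\<^sub>R (- u))) has_vector_derivative
        - bump_deriv u (z - p + t *\<^sub>R (- u))) (at t)"
      unfolding dir_deriv_eq[OF bump_has_derivative] by (simp add: bump_deriv_def)
    then have "((\<lambda>t. bump (z - p + t *\<^sub>R (- u)) *\<^sub>R F z) has_vector_derivative
        - bump_deriv u (z - p + t *\<^sub>R (- u)) *\<^sub>R F z) (at t)"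
      by (intro has_vector_derivative_scaleR[where g = "\<lambda>_. F z" and g' = 0, simplified])
         (simp_all add: has_real_derivative_iff_has_vector_derivative)
    then show "((\<lambda>t. bump (z - (p + t *\<^sub>R u)) *\<^sub>R F z) has_vector_derivative
        - bump_deriv u (z - (p + t *\<^sub>R u)) *\<^sub>R F z) (at t)"
      by (simp add: algebra_simps)
  next
    fix t :: real
    show "(\<lambda>z. bump (z - (p + t *\<^sub>R u)) *\<^sub>R F z) integrable_on box2"
      by (intro integrable_continuous continuous_intros continuous_on_compose2[OF contb(1)] F) auto
    show "continuous_on (UNIV \<times> box2) (\<lambda>(t, z). - bump_deriv u (z - (p + t *\<^sub>R u)) *\<^sub>R F z)"
      unfolding split_beta
      by (intro continuous_intros continuous_on_compose2[OF contb(2)] continuous_on_compose2[OF F]) auto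
  qed auto
  moreover have "integral box2 (\<lambda>z. - bump_deriv u (z - (p + 0 *\<^sub>R u)) *\<^sub>R F z) = - mollify (bump_deriv u) F p"
    using p by (subst mollify_box) (simp_all add: bump_outside)
  ultimately have "((\<lambda>t. integral box2 (\<lambda>z. bump (z - (p + t *\<^sub>R u)) *\<^sub>R F z)) has_vector_derivative
      - mollify (bump_deriv u) F p) (at 0)" by simp
  then show ?thesis
  proof (rule has_vector_derivative_transform_within_open)
    show "open {t. norm (p + t *\<^sub>R u) < 1}" by (rule open_line_ball)
    show "integral box2 (\<lambda>z. bump (z - (p + t *\<^sub>R u)) *\<^sub>R F z) = mollify bump F (p + t *\<^sub>R u)"
      if "t \<in> {t. norm (p + t *\<^sub>R u) < 1}" for t
      using that by (subst mollify_box) (simp_all add: bump_outside)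
  qed (use p in auto)
qed

text \<open>The counterpart with the derivative on \<open>F\<close>; here the kernel needs only
  continuity, so it may itself be \<open>bump_deriv w\<close>.\<close>

lemma mollify_derivative:
  fixes F :: "'a::euclidean_space \<Rightarrow> 'b::banach"
  assumes F: "C1_on D F" and D: "box2 \<subseteq> D" and k: "continuous_on UNIV k"
    and supp: "\<And>y. norm y > 1 \<Longrightarrow> k y = 0" and p: "norm p < 1"
  shows "((\<lambda>t. mollify k F (p + t *\<^sub>R u)) has_vector_derivative mollify k (dir_deriv u F) p) (at 0)"
proof -
  have box1: "mollify k G q = integral box1 (\<lambda>y. k y *\<^sub>R G (q + y))" for G :: "'a \<Rightarrow> 'b" and q
  proof -
    have "k y = 0" if "y \<notin> box1" for y
      using that cball_subset_cbox[of 1, where 'a='a] by (intro supp) (auto simp: subset_eq not_le)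
    moreover have "mollify k G q = integral UNIV (\<lambda>y. k y *\<^sub>R G (q + y))"
      by (rule mollify_shift) (rule supp)
    ultimately show ?thesis by (subst integral_UNIV_eq[of box1, symmetric]) simp_all
  qed
  have "0 \<in> {t::real. norm (p + t *\<^sub>R u) < 1}" using p by simp
  then obtain d where d: "d > 0" "ball 0 d \<subseteq> {t::real. norm (p + t *\<^sub>R u) < 1}"
    by (rule openE[OF open_line_ball])
  have inD: "p + t *\<^sub>R u + y \<in> D" if "t \<in> ball 0 d" "y \<in> box1" for t y
  proof -
    have "norm (p + t *\<^sub>R u) \<le> 1" using subsetD[OF d(2) that(1)] by simp
    from translate_box1[OF this that(2)] show ?thesis using D by blast
  qed
  have contF: "continuous_on D F" and cont': "continuous_on D (dir_deriv u F)"
    and diff: "\<And>x. x \<in> D \<Longrightarrow> F differentiable (at x)"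
    using F C1_on_continuous[OF F] by (auto simp: C1_on_def)
  have "((\<lambda>t. integral box1 (\<lambda>y. k y *\<^sub>R F (p + t *\<^sub>R u + y))) has_vector_derivative
      integral box1 (\<lambda>y. k y *\<^sub>R dir_deriv u F (p + 0 *\<^sub>R u + y))) (at 0 within ball 0 d)"
  proof (rule leibniz_rule_vector_derivative)
    fix t :: real and y :: 'a assume ty: "t \<in> ball 0 d" "y \<in> box1"
    have "((\<lambda>t. F (p + y + t *\<^sub>R u)) has_vector_derivative dir_deriv u F (p + y + t *\<^sub>R u)) (at t within ball 0 d)"
      using inD[OF ty] by (intro has_vector_derivative_line diff) (simp add: algebra_simps)
    from has_vector_derivative_scaleR[OF DERIV_const this, of "k y"]
    show "((\<lambda>t. k y *\<^sub>R F (p + t *\<^sub>R u + y)) has_vector_derivative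
        k y *\<^sub>R dir_deriv u F (p + t *\<^sub>R u + y)) (at t within ball 0 d)"
      by (simp add: algebra_simps)
  next
    fix t :: real assume "t \<in> ball 0 d"
    then show "(\<lambda>y. k y *\<^sub>R F (p + t *\<^sub>R u + y)) integrable_on box1"
      using inD
      by (intro integrable_continuous continuous_intros continuous_on_compose2[OF contF]
          continuous_on_subset[OF k]) auto
  next
    show "continuous_on (ball 0 d \<times> box1) (\<lambda>(t, y). k y *\<^sub>R dir_deriv u F (p + t *\<^sub>R u + y))"
      unfolding split_beta using inD
      by (intro continuous_intros continuous_on_compose2[OF k] continuous_on_compose2[OF cont']) auto
  qed (use d in auto)
  moreover have "at 0 within ball 0 d = at (0::real)" using d by (intro at_within_open) auto
  ultimately show ?thesis by (simp add: box1)
qed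

text \<open>\<open>L i\<close> stands for left multiplication by \<open>v i\<close> and
  \<open>L' i\<close> for left multiplication by its conjugate. Without associativity the composite
  of two left multiplications need not be a left multiplication, so the Clifford-type relations are
  imposed on composites of operators. \<open>I\<close> may index fewer directions than the dimension
  of the domain.\<close>

locale dirac_system =
  fixes I :: "'i set" and v :: "'i \<Rightarrow> 'a::euclidean_space" and L L' :: "'i \<Rightarrow> 'b::euclidean_space \<Rightarrow> 'b"
  assumes finite_I: "finite I"
    and linear_L: "i \<in> I \<Longrightarrow> linear (L i)" and linear_L': "i \<in> I \<Longrightarrow> linear (L' i)"
    and orthogonal_v: "i \<in> I \<Longrightarrow> j \<in> I \<Longrightarrow> i \<noteq> j \<Longrightarrow> v i \<bullet> v j = 0"
    and L'_L: "i \<in> I \<Longrightarrow> L' i (L i x) = x"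
    and L'_L_anticommute: "i \<in> I \<Longrightarrow> j \<in> I \<Longrightarrow> i \<noteq> j \<Longrightarrow> L' i (L j x) + L' j (L i x) = 0"
begin

text \<open>The last clause says that no derivative is seen across the span of the
  \<open>v i\<close>: it encodes functions of the coordinates in \<open>M\<close> extended
  constantly, in a form that passes to derivatives.\<close>

definition solution :: "'a set \<Rightarrow> ('a \<Rightarrow> 'b) \<Rightarrow> bool" where
  "solution D F \<longleftrightarrow> C1_on D F \<and>
     (\<forall>x\<in>D. (\<Sum>i\<in>I. L i (dir_deriv (v i) F x)) = 0) \<and>
     (\<forall>x\<in>D. \<forall>y. dir_deriv y F x = (\<Sum>i\<in>I. (y \<bullet> v i) *\<^sub>R dir_deriv (v i) F x))"

lemma solution_C1: "solution D F \<Longrightarrow> C1_on D F"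
  and solution_eq: "solution D F \<Longrightarrow> x \<in> D \<Longrightarrow> (\<Sum>i\<in>I. L i (dir_deriv (v i) F x)) = 0"
  and solution_expand: "solution D F \<Longrightarrow> x \<in> D \<Longrightarrow>
    dir_deriv y F x = (\<Sum>i\<in>I. (y \<bullet> v i) *\<^sub>R dir_deriv (v i) F x)"
  unfolding solution_def by blast+

text \<open>Apply the sum of the \<open>(y \<bullet> v i) *\<^sub>R L' i\<close> to the system. The
  diagonal terms add up to the derivative along \<open>y\<close> by \<open>L'_L\<close>. Adding the
  vanishing double sum to its transpose and using anticommutation turns the rest into antisymmetric
  combinations, which for \<open>y = x\<close> are rotation fields.\<close>

lemma radial_derivative:
  assumes "solution D F" "x \<in> D"
  shows "dir_deriv y F x = - (1/2) *\<^sub>R (\<Sum>i\<in>I. \<Sum>j\<in>I. L' i (L j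
     ((y \<bullet> v i) *\<^sub>R dir_deriv (v j) F x - (y \<bullet> v j) *\<^sub>R dir_deriv (v i) F x)))"
proof -
  define G where "G i = dir_deriv (v i) F x" for i
  define T where "T i j = L' i (L j ((y \<bullet> v i) *\<^sub>R G j))" for i j
  have lin: "linear (\<lambda>x. L' i (L j x))" if "i \<in> I" "j \<in> I" for i j
    using linear_compose[OF linear_L[OF that(2)] linear_L'[OF that(1)]] by (simp add: o_def)
  have "(\<Sum>i\<in>I. \<Sum>j\<in>I. T i j) = (\<Sum>i\<in>I. (y \<bullet> v i) *\<^sub>R L' i (\<Sum>j\<in>I. L j (G j)))"
    unfolding T_def
    by (intro sum.cong) (simp_all add: linear_sum[OF linear_L'] linear_cmul[OF lin] scaleR_right.sum)
  also have "\<dots> = 0"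
    unfolding G_def solution_eq[OF assms] by (simp add: linear_0[OF linear_L'])
  finally have T0: "(\<Sum>i\<in>I. \<Sum>j\<in>I. T i j) = 0" .
  have "(\<Sum>i\<in>I. \<Sum>j\<in>I. L' i (L j ((y \<bullet> v i) *\<^sub>R G j - (y \<bullet> v j) *\<^sub>R G i)))
      = (\<Sum>i\<in>I. \<Sum>j\<in>I. T i j + T j i - (if j = i then 2 *\<^sub>R ((y \<bullet> v i) *\<^sub>R G i) else 0))"
  proof (intro sum.cong refl)
    fix i j assume ij: "i \<in> I" "j \<in> I"
    show "L' i (L j ((y \<bullet> v i) *\<^sub>R G j - (y \<bullet> v j) *\<^sub>R G i))
      = T i j + T j i - (if j = i then 2 *\<^sub>R ((y \<bullet> v i) *\<^sub>R G i) else 0)"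
    proof (cases "i = j")
      case True
      then show ?thesis using ij by (simp add: T_def L'_L linear_0[OF lin] flip: scaleR_left_distrib)
    next
      case False
      have "L' j (L i z) = - L' i (L j z)" for z
        using L'_L_anticommute[OF ij False, of z] by (simp add: eq_neg_iff_add_eq_0 add.commute)
      then show ?thesis using ij False
        by (simp add: T_def linear_diff[OF lin] linear_cmul[OF lin])
    qed
  qed
  also have "\<dots> = (\<Sum>i\<in>I. \<Sum>j\<in>I. T i j) + (\<Sum>i\<in>I. \<Sum>j\<in>I. T j i) - 2 *\<^sub>R (\<Sum>i\<in>I. (y \<bullet> v i) *\<^sub>R G i)"
    by (simp add: sum.distrib sum_subtractf finite_I scaleR_right.sum)
  also have "(\<Sum>i\<in>I. \<Sum>j\<in>I. T j i) = (\<Sum>i\<in>I. \<Sum>j\<in>I. T i j)" by (rule sum.swap)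
  also have "(\<Sum>i\<in>I. (y \<bullet> v i) *\<^sub>R G i) = dir_deriv y F x"
    unfolding G_def by (rule solution_expand[OF assms, symmetric])
  finally show ?thesis by (simp add: T0 G_def)
qed

lemma solution_affine:
  assumes "solution D F"
  shows "solution {y. p + r *\<^sub>R y \<in> D} (\<lambda>y. F (p + r *\<^sub>R y))"
proof -
  have F: "C1_on D F" by (rule solution_C1[OF assms])
  have d: "dir_deriv u (\<lambda>y. F (p + r *\<^sub>R y)) x = r *\<^sub>R dir_deriv u F (p + r *\<^sub>R x)"
    if "p + r *\<^sub>R x \<in> D" for u x
    using F that by (intro dir_deriv_affine) (simp add: C1_on_def)
  have "(\<Sum>i\<in>I. L i (dir_deriv (v i) (\<lambda>y. F (p + r *\<^sub>R y)) x)) = 0" if "p + r *\<^sub>R x \<in> D" for x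
  proof -
    have "(\<Sum>i\<in>I. L i (dir_deriv (v i) (\<lambda>y. F (p + r *\<^sub>R y)) x))
        = r *\<^sub>R (\<Sum>i\<in>I. L i (dir_deriv (v i) F (p + r *\<^sub>R x)))"
      by (simp add: d[OF that] scaleR_right.sum linear_cmul[OF linear_L] cong: sum.cong)
    then show ?thesis using solution_eq[OF assms that] by simp
  qed
  moreover have "dir_deriv y (\<lambda>y. F (p + r *\<^sub>R y)) x
     = (\<Sum>i\<in>I. (y \<bullet> v i) *\<^sub>R dir_deriv (v i) (\<lambda>y. F (p + r *\<^sub>R y)) x)" if "p + r *\<^sub>R x \<in> D" for x y
  proof -
    have "dir_deriv y F (p + r *\<^sub>R x) = (\<Sum>i\<in>I. (y \<bullet> v i) *\<^sub>R dir_deriv (v i) F (p + r *\<^sub>R x))"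
      by (rule solution_expand[OF assms that])
    then show ?thesis by (simp add: d[OF that] scaleR_right.sum mult.commute)
  qed
  ultimately show ?thesis
    using C1_on_affine[OF F] by (simp add: solution_def)
qed

text \<open>With the point itself as direction, the radial derivative becomes a combination of
  constant linear images of rotation fields, and linear maps commute with the integral.\<close>

lemma integral_bump_radial:
  assumes "solution D F" "cball 0 1 \<subseteq> D"
  shows "integral UNIV (\<lambda>y. bump y *\<^sub>R dir_deriv y F y) = 0"
proof -
  define R where "R i j y = bump y *\<^sub>R
      ((y \<bullet> v i) *\<^sub>R dir_deriv (v j) F y - (y \<bullet> v j) *\<^sub>R dir_deriv (v i) F y)" for i j y
  have lin: "linear (\<lambda>x. L' i (L j x))" if "i \<in> I" "j \<in> I" for i j
    using linear_compose[OF linear_L[OF that(2)] linear_L'[OF that(1)]] by (simp add: o_def)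
  have "((\<lambda>y. L' i (L j (R i j y))) has_integral 0) UNIV" if "i \<in> I" "j \<in> I" for i j
  proof (cases "i = j")
    case True
    then show ?thesis using that by (simp add: R_def linear_0[OF lin])
  next
    case False
    have "(R i j has_integral 0) UNIV"
      unfolding R_def using assms
      by (intro integral_bump_rotation[of D] orthogonal_v that False solution_C1)
    from has_integral_linear[OF this linear_conv_bounded_linear[THEN iffD1, OF lin[OF that]]]
    show ?thesis by (simp add: o_def linear_0[OF lin[OF that]])
  qed
  then have "((\<lambda>y. - (1/2) *\<^sub>R (\<Sum>i\<in>I. \<Sum>j\<in>I. L' i (L j (R i j y)))) has_integral
      - (1/2) *\<^sub>R (\<Sum>i\<in>I. \<Sum>j\<in>I. 0)) UNIV"
    by (intro has_integral_cmul has_integral_sum finite_I)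
  moreover have "bump y *\<^sub>R dir_deriv y F y = - (1/2) *\<^sub>R (\<Sum>i\<in>I. \<Sum>j\<in>I. L' i (L j (R i j y)))" for y
  proof (cases "y \<in> D")
    case True
    show ?thesis
      unfolding radial_derivative[OF assms(1) True, of y]
      by (simp add: R_def linear_cmul[OF lin] scaleR_right.sum cong: sum.cong)
  next
    case False
    then have "bump y = 0" using assms(2) by (intro bump_outside) (auto simp: subset_eq)
    then show ?thesis by (simp add: R_def linear_0[OF lin])
  qed
  ultimately show ?thesis by (simp add: has_integral_iff)
qed

text \<open>The weighted average \<open>A r\<close> of \<open>F (r *\<^sub>R y)\<close> has as
  derivative the weighted integral of a radial derivative of the rescaled solution, divided by
  \<open>r\<close>, hence zero. So \<open>A\<close> has the same value at 1 and in the limit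
  \<open>r = 0\<close>, where it is the mass of the weight times \<open>F 0\<close>.\<close>

lemma mean_value_0:
  assumes F: "solution D F" and D: "box1 \<subseteq> D"
  shows "integral UNIV (\<lambda>y. bump y *\<^sub>R F y) = integral UNIV (bump :: 'a \<Rightarrow> real) *\<^sub>R F 0"
proof -
  have box: "bump y = 0" if "y \<notin> box1" for y :: 'a
    using that cball_subset_cbox[of 1, where 'a='a] by (intro bump_outside) (auto simp: subset_eq not_le)
  have C1: "C1_on D F" by (rule solution_C1[OF F])
  have contF: "continuous_on D F" and cont': "\<And>u. continuous_on D (dir_deriv u F)"
    and diff: "\<And>x. x \<in> D \<Longrightarrow> F differentiable (at x)"
    using C1 C1_on_continuous[OF C1] by (auto simp: C1_on_def)
  have inD: "r *\<^sub>R y \<in> D" if "r \<in> {0..1}" "y \<in> box1" for r y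
  proof -
    have "(0::'a) \<in> box1" using cball_subset_cbox[of 1, where 'a='a] by auto
    then have "(1 - r) *\<^sub>R 0 + r *\<^sub>R y \<in> box1"
      using that by (intro convexD[OF convex_box(1)]) auto
    then show ?thesis using D by auto
  qed
  define A where "A r = integral box1 (\<lambda>y. bump y *\<^sub>R F (r *\<^sub>R y))" for r :: real
  have A': "(A has_vector_derivative integral box1 (\<lambda>y. bump y *\<^sub>R dir_deriv y F (r *\<^sub>R y)))
      (at r within {0..1})" if r: "r \<in> {0..1}" for r
    unfolding A_def
  proof (rule leibniz_rule_vector_derivative[OF _ _ _ r])
    fix r :: real and y :: 'a assume ry: "r \<in> {0..1}" "y \<in> box1"
    have "((\<lambda>r. F (0 + r *\<^sub>R y)) has_vector_derivative dir_deriv y F (0 + r *\<^sub>R y)) (at r within {0..1})"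
      using inD[OF ry] by (intro has_vector_derivative_line diff) simp
    from has_vector_derivative_scaleR[OF DERIV_const this, of "bump y"]
    show "((\<lambda>r. bump y *\<^sub>R F (r *\<^sub>R y)) has_vector_derivative bump y *\<^sub>R dir_deriv y F (r *\<^sub>R y))
        (at r within {0..1})" by simp
  next
    fix r :: real assume "r \<in> {0..1}"
    then show "(\<lambda>y. bump y *\<^sub>R F (r *\<^sub>R y)) integrable_on box1"
      using inD
      by (intro integrable_continuous continuous_intros continuous_on_compose2[OF contF]) auto
  next
    \<comment> \<open>The direction \<open>y\<close> varies with the point, whereas
      \<open>C1_on\<close> controls fixed directions only; the expansion along the
      \<open>v i\<close> reduces to these.\<close>
    have "continuous_on ({0..1} \<times> box1)
        (\<lambda>x. bump (snd x) *\<^sub>R (\<Sum>i\<in>I. (snd x \<bullet> v i) *\<^sub>R dir_deriv (v i) F (fst x *\<^sub>R snd x)))"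
      using inD by (intro continuous_intros continuous_on_compose2[OF cont']) auto
    then show "continuous_on ({0..1} \<times> box1) (\<lambda>(r, y). bump y *\<^sub>R dir_deriv y F (r *\<^sub>R y))"
      unfolding split_beta
    proof (rule continuous_on_eq)
      fix x :: "real \<times> 'a" assume "x \<in> {0..1} \<times> box1"
      then have "fst x *\<^sub>R snd x \<in> D" using inD by auto
      from solution_expand[OF F this, of "snd x"] show "bump (snd x) *\<^sub>R (\<Sum>i\<in>I. (snd x \<bullet> v i) *\<^sub>R dir_deriv (v i) F (fst x *\<^sub>R snd x))
          = bump (snd x) *\<^sub>R dir_deriv (snd x) F (fst x *\<^sub>R snd x)" by (rule arg_cong[OF sym])
    qed
  qed auto
  have zero: "integral box1 (\<lambda>y. bump y *\<^sub>R dir_deriv y F (r *\<^sub>R y)) = 0" if r: "r \<in> {0<..1}" for r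
  proof -
    let ?D = "{y. 0 + r *\<^sub>R y \<in> D}" and ?F = "\<lambda>y. F (0 + r *\<^sub>R y)"
    have sub: "box1 \<subseteq> ?D" using inD r by auto
    then have "integral UNIV (\<lambda>y. bump y *\<^sub>R dir_deriv y ?F y) = 0"
      using cball_subset_cbox[of 1, where 'a='a]
      by (intro integral_bump_radial[OF solution_affine[OF F]]) blast
    moreover have "integral UNIV (\<lambda>y. bump y *\<^sub>R dir_deriv y ?F y) = integral box1 (\<lambda>y. bump y *\<^sub>R dir_deriv y ?F y)"
      by (intro integral_UNIV_eq) (simp add: box)
    moreover have "integral box1 (\<lambda>y. bump y *\<^sub>R dir_deriv y ?F y)
        = integral box1 (\<lambda>y. r *\<^sub>R (bump y *\<^sub>R dir_deriv y F (r *\<^sub>R y)))"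
    proof (intro integral_cong)
      fix y :: 'a assume "y \<in> box1"
      then have "0 + r *\<^sub>R y \<in> D" using sub by auto
      from dir_deriv_affine(2)[OF diff[OF this], of y]
      show "bump y *\<^sub>R dir_deriv y ?F y = r *\<^sub>R (bump y *\<^sub>R dir_deriv y F (r *\<^sub>R y))"
        by simp
    qed
    ultimately have "r *\<^sub>R integral box1 (\<lambda>y. bump y *\<^sub>R dir_deriv y F (r *\<^sub>R y)) = 0"
      by (simp only: integral_cmul)
    then show ?thesis using r by simp
  qed
  have "(A has_vector_derivative 0) (at r within {0<..1})" if "r \<in> {0<..1}" for r
  proof -
    have "{0<..1} \<subseteq> {0..1::real}" by auto
    with has_vector_derivative_within_subset[OF A', of r "{0<..1}"] that zero[OF that]
    show ?thesis by auto
  qed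
  then obtain c where c: "\<And>r. r \<in> {0<..1} \<Longrightarrow> A r = c"
    by (rule has_vector_derivative_zero_constant[of "{0<..1}", rotated]) auto
  \<comment> \<open>The division by \<open>r\<close> excluded the left endpoint; it is recovered by
    continuity.\<close>
  have "continuous_on (closure {0<..1}) A"
    using has_vector_derivative_continuous[OF A'] by (simp add: continuous_on_eq_continuous_within)
  then have "A 0 = c"
    by (rule continuous_constant_on_closure) (use c in auto)
  then have "A 1 = A 0" using c[of 1] by simp
  moreover have "A 1 = integral UNIV (\<lambda>y. bump y *\<^sub>R F y)"
    unfolding A_def by (subst integral_UNIV_eq[of box1]) (simp_all add: box)
  moreover have "A 0 = integral UNIV (bump :: 'a \<Rightarrow> real) *\<^sub>R F 0"
  proof -
    have "(bump :: 'a \<Rightarrow> real) integrable_on box1"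
      using continuous_on_bump(1)[OF continuous_on_id] by (intro integrable_continuous) simp
    then have "A 0 = integral box1 (bump :: 'a \<Rightarrow> real) *\<^sub>R F 0"
      unfolding A_def by (simp add: integral_unique has_integral_scaleR_left integrable_integral)
    then show ?thesis by (subst integral_UNIV_eq[of box1]) (simp_all add: box)
  qed
  ultimately show ?thesis by simp
qed

lemma mean_value:
  assumes F: "solution D F" and D: "box2 \<subseteq> D" and p: "norm p < 1"
  shows "mollify bump F p = integral UNIV (bump :: 'a \<Rightarrow> real) *\<^sub>R F p"
proof -
  have "box1 \<subseteq> {y. p + 1 *\<^sub>R y \<in> D}" using translate_box1[of p] p D by fastforce
  from mean_value_0[OF solution_affine[OF F] this] show ?thesis
    by (simp add: mollify_shift bump_outside)
qed

end

section \<open>Regularity and Cauchy estimates\<close>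

text \<open>\<open>k ^ k / fact k\<close> is a single term of the exponential series at
  \<open>k\<close>. The bound plays the part of Stirling's formula when \<open>k\<close> nested
  Cauchy estimates meet the factorial of Taylor's formula.\<close>

lemma power_self_le_fact_exp: "real k ^ k \<le> fact k * exp 1 ^ k"
proof -
  have "(\<Sum>n\<in>{k}. real k ^ n /\<^sub>R fact n) \<le> (\<Sum>n. real k ^ n /\<^sub>R fact n)"
    by (intro sum_le_suminf summable_exp_generic) auto
  then have "real k ^ k / fact k \<le> exp (real k)"
    by (simp add: exp_def divide_inverse mult.commute)
  also have "exp (real k) = exp 1 ^ k" using exp_of_nat_mult[of k "1::real"] by simp
  finally show ?thesis by (simp add: divide_le_eq mult.commute)
qed

abbreviation bump_mass :: "'a::euclidean_space itself \<Rightarrow> real" where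
  "bump_mass _ \<equiv> integral UNIV (bump :: 'a \<Rightarrow> real)"

lemma dir_deriv_cong_open:
  assumes "open T" "x \<in> T" "\<And>y. y \<in> T \<Longrightarrow> f y = g y" "f differentiable (at x)"
  shows "g differentiable (at x)" "dir_deriv u g x = dir_deriv u f x"
proof -
  have "(g has_derivative (\<lambda>u. dir_deriv u f x)) (at x)"
    by (rule has_derivative_transform_within_open[OF differentiable_dir_deriv[OF assms(4)] assms(1,2)])
      (use assms(3) in auto)
  then show "g differentiable (at x)" "dir_deriv u g x = dir_deriv u f x"
    by (auto simp: differentiable_def dir_deriv_eq)
qed

context dirac_system
begin

lemma solution_cong:
  assumes F: "solution T F" and eq: "\<And>x. x \<in> T \<Longrightarrow> F x = G x"
  shows "solution T G"
proof -
  have T: "open T" and diff: "\<And>x. x \<in> T \<Longrightarrow> F differentiable (at x)"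
    and cont: "\<And>u. continuous_on T (dir_deriv u F)"
    using solution_C1[OF F] by (auto simp: C1_on_def)
  note G = dir_deriv_cong_open[OF T _ eq diff]
  have "continuous_on T (dir_deriv u G)" for u
    by (rule continuous_on_eq[OF cont]) (simp add: G(2))
  then have "C1_on T G" using T G(1) by (simp add: C1_on_def)
  moreover have "(\<Sum>i\<in>I. L i (dir_deriv (v i) G x)) = 0" if "x \<in> T" for x
    using solution_eq[OF F that] that by (simp add: G(2))
  moreover have "dir_deriv y G x = (\<Sum>i\<in>I. (y \<bullet> v i) *\<^sub>R dir_deriv (v i) G x)" if "x \<in> T" for x y
    using solution_expand[OF F that, of y] that by (simp add: G(2))
  ultimately show ?thesis unfolding solution_def by blast
qed

text \<open>All clauses concern germs at points; this glues results obtained on small rescaled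
  balls.\<close>

lemma solution_local:
  assumes "open D" and loc: "\<And>p. p \<in> D \<Longrightarrow> \<exists>T. p \<in> T \<and> solution T F"
  shows "solution D F"
proof -
  have "F differentiable (at p) \<and> (\<forall>u. continuous (at p) (dir_deriv u F)) \<and>
      (\<Sum>i\<in>I. L i (dir_deriv (v i) F p)) = 0 \<and>
      (\<forall>y. dir_deriv y F p = (\<Sum>i\<in>I. (y \<bullet> v i) *\<^sub>R dir_deriv (v i) F p))" if p: "p \<in> D" for p
  proof -
    obtain T where T: "p \<in> T" "solution T F" using loc[OF p] by blast
    then have "open T" "F differentiable (at p)" "\<And>u. continuous_on T (dir_deriv u F)"
      using solution_C1[OF T(2)] by (auto simp: C1_on_def)
    with T(1) have "\<forall>u. continuous (at p) (dir_deriv u F)"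
      by (auto simp: continuous_on_eq_continuous_at)
    then show ?thesis
      using \<open>F differentiable (at p)\<close> solution_eq[OF T(2,1)] solution_expand[OF T(2,1)] by blast
  qed
  then show ?thesis using assms(1)
    unfolding solution_def C1_on_def continuous_on_eq_continuous_at[OF assms(1)] by blast
qed

section \<open>Gain of differentiability at unit scale\<close>

context
  fixes D :: "'a set" and F :: "'a \<Rightarrow> 'b"
  assumes F: "solution D F" and D: "box2 \<subseteq> D"
begin

lemma unit_in_domain: "norm p < 1 \<Longrightarrow> p \<in> D"
proof -
  assume "norm p < 1"
  then have "p \<in> cball 0 2" by simp
  then show "p \<in> D" using D cball_subset_cbox[of 2, where 'a='a] by blast
qed

lemma continuous_on_box2: "continuous_on box2 F" "continuous_on box2 (dir_deriv u F)"
proof -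
  show "continuous_on box2 F"
    by (rule continuous_on_subset[OF C1_on_continuous[OF solution_C1[OF F]] D])
  have "continuous_on D (dir_deriv u F)" using solution_C1[OF F] by (simp add: C1_on_def)
  then show "continuous_on box2 (dir_deriv u F)" by (rule continuous_on_subset[OF _ D])
qed

lemma line_derivative:
  assumes "norm p < 1"
  shows "((\<lambda>t. F (p + t *\<^sub>R u)) has_vector_derivative dir_deriv u F p) (at 0)"
  using has_vector_derivative_line[of F p 0 u UNIV] solution_C1[OF F] unit_in_domain[OF assms]
  by (simp add: C1_on_def)

lemma mean_value_line:
  assumes p: "norm p < 1" and d: "((\<lambda>t. mollify bump F (p + t *\<^sub>R u)) has_vector_derivative d) (at 0)"
  shows "bump_mass TYPE('a) *\<^sub>R dir_deriv u F p = d"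
proof -
  have "((\<lambda>t. bump_mass TYPE('a) *\<^sub>R F (p + t *\<^sub>R u)) has_vector_derivative d) (at 0)"
    by (rule has_vector_derivative_transform_within_open[OF d open_line_ball[of p u 1]])
      (use p mean_value[OF F D] in auto)
  moreover have "((\<lambda>t. bump_mass TYPE('a) *\<^sub>R F (p + t *\<^sub>R u)) has_vector_derivative bump_mass TYPE('a) *\<^sub>R dir_deriv u F p) (at 0)"
    using has_vector_derivative_scaleR[OF DERIV_const line_derivative[OF p], of "bump_mass TYPE('a)" u] by simp
  ultimately show ?thesis by (metis vector_derivative_unique_at)
qed

lemma continuous_kernel: "continuous_on UNIV (bump :: 'a \<Rightarrow> real)" "continuous_on UNIV (bump_deriv (w :: 'a))"
  using continuous_on_bump[OF continuous_on_id, of UNIV] by auto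

text \<open>The mean value identity is differentiated in two ways. The first formula says that
  derivatives inherit the mean value property; the second expresses them through values of
  \<open>F\<close> alone, which is the source of the Cauchy estimates.\<close>

lemma derivative_mean_value:
  assumes p: "norm p < 1"
  shows "bump_mass TYPE('a) *\<^sub>R dir_deriv u F p = mollify bump (dir_deriv u F) p"
    "bump_mass TYPE('a) *\<^sub>R dir_deriv u F p = - mollify (bump_deriv u) F p"
  by (rule mean_value_line[OF p mollify_derivative[OF solution_C1[OF F] D continuous_kernel(1) _ p]])
     (simp add: bump_outside,
      rule mean_value_line[OF p mollify_bump_derivative[OF continuous_on_box2(1) p]])

text \<open>
  The first derivatives can be put on \<open>F\<close> or on the kernel, so both mixed second derivatives exist
  and are given by the same mollification; no \<open>C\<^sup>2\<close> assumption is needed.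
\<close>

lemma second_derivative:
  assumes p: "norm p < 1"
  shows "((\<lambda>t. dir_deriv u F (p + t *\<^sub>R w)) has_vector_derivative
      (- 1 / bump_mass TYPE('a)) *\<^sub>R mollify (bump_deriv w) (dir_deriv u F) p) (at 0)"
    "((\<lambda>t. dir_deriv w F (p + t *\<^sub>R u)) has_vector_derivative
      (- 1 / bump_mass TYPE('a)) *\<^sub>R mollify (bump_deriv w) (dir_deriv u F) p) (at 0)"
proof -
  have pos: "bump_mass TYPE('a) > 0" by (rule integral_bump_pos)
  have "((\<lambda>t. (1 / bump_mass TYPE('a)) *\<^sub>R mollify bump (dir_deriv u F) (p + t *\<^sub>R w)) has_vector_derivative
      (1 / bump_mass TYPE('a)) *\<^sub>R - mollify (bump_deriv w) (dir_deriv u F) p) (at 0)"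
    using has_vector_derivative_scaleR[OF DERIV_const
        mollify_bump_derivative[OF continuous_on_box2(2) p], of "1 / bump_mass TYPE('a)" u w] by simp
  then have "((\<lambda>t. dir_deriv u F (p + t *\<^sub>R w)) has_vector_derivative
      (1 / bump_mass TYPE('a)) *\<^sub>R - mollify (bump_deriv w) (dir_deriv u F) p) (at 0)"
    by (rule has_vector_derivative_transform_within_open[OF _ open_line_ball[of p w 1]])
      (use p pos in \<open>auto simp flip: derivative_mean_value(1)\<close>)
  then show "((\<lambda>t. dir_deriv u F (p + t *\<^sub>R w)) has_vector_derivative
      (- 1 / bump_mass TYPE('a)) *\<^sub>R mollify (bump_deriv w) (dir_deriv u F) p) (at 0)" by simp
  have "((\<lambda>t. mollify (bump_deriv w) F (p + t *\<^sub>R u)) has_vector_derivative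
      mollify (bump_deriv w) (dir_deriv u F) p) (at 0)"
    by (rule mollify_derivative[OF solution_C1[OF F] D continuous_kernel(2) _ p]) (simp add: bump_outside)
  from has_vector_derivative_scaleR[OF DERIV_const this, of "- 1 / bump_mass TYPE('a)"]
  have "((\<lambda>t. (- 1 / bump_mass TYPE('a)) *\<^sub>R mollify (bump_deriv w) F (p + t *\<^sub>R u)) has_vector_derivative
      (- 1 / bump_mass TYPE('a)) *\<^sub>R mollify (bump_deriv w) (dir_deriv u F) p) (at 0)" by simp
  then show "((\<lambda>t. dir_deriv w F (p + t *\<^sub>R u)) has_vector_derivative
      (- 1 / bump_mass TYPE('a)) *\<^sub>R mollify (bump_deriv w) (dir_deriv u F) p) (at 0)"
  proof (rule has_vector_derivative_transform_within_open[OF _ open_line_ball[of p u 1]])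
    fix t assume "t \<in> {t. norm (p + t *\<^sub>R u) < 1}"
    then have "bump_mass TYPE('a) *\<^sub>R dir_deriv w F (p + t *\<^sub>R u) = - mollify (bump_deriv w) F (p + t *\<^sub>R u)"
      by (intro derivative_mean_value(2)) simp
    then have "mollify (bump_deriv w) F (p + t *\<^sub>R u) = - (bump_mass TYPE('a) *\<^sub>R dir_deriv w F (p + t *\<^sub>R u))" by simp
    then show "(- 1 / bump_mass TYPE('a)) *\<^sub>R mollify (bump_deriv w) F (p + t *\<^sub>R u) = dir_deriv w F (p + t *\<^sub>R u)"
      using pos by simp
  qed (use p in auto)
qed

text \<open>The line derivatives of \<open>dir_deriv u F\<close> are again mollifications with a
  continuous kernel, hence continuous; continuous partial derivatives then give full
  differentiability.\<close>

lemma C1_on_dir_deriv_unit: "C1_on (ball 0 1) (dir_deriv u F)"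
proof (rule C1_on_partials(1)[where J = Basis and b = "\<lambda>i. i" and c = "\<lambda>i h. h \<bullet> i"])
  show "((\<lambda>t. dir_deriv u F (p + t *\<^sub>R i)) has_vector_derivative
      (- 1 / bump_mass TYPE('a)) *\<^sub>R mollify (bump_deriv i) (dir_deriv u F) p) (at 0)" if "p \<in> ball 0 1" for i p
    using that by (intro second_derivative(1)) simp
  have "continuous_on (cball 0 1) (mollify (bump_deriv i) (dir_deriv u F))" for i
    by (rule continuous_on_mollify[OF continuous_on_box2(2) continuous_kernel(2)]) (simp add: bump_outside)
  then show "continuous_on (ball 0 1) (\<lambda>p. (- 1 / bump_mass TYPE('a)) *\<^sub>R mollify (bump_deriv i) (dir_deriv u F) p)" for i
    by (intro continuous_on_scaleR continuous_on_const continuous_on_subset[OF _ ball_subset_cball])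
qed (auto simp: euclidean_representation bounded_linear_inner_left)

lemma second_derivative_symmetric:
  assumes "norm p < 1"
  shows "dir_deriv w (dir_deriv u F) p = dir_deriv u (dir_deriv w F) p"
  unfolding dir_deriv_def[of w "dir_deriv u F"] dir_deriv_def[of u "dir_deriv w F"]
    vector_derivative_at[OF second_derivative(1)[OF assms, where u = u and w = w]]
    vector_derivative_at[OF second_derivative(2)[OF assms, where u = u and w = w]] ..

text \<open>The system has constant coefficients, so it can be differentiated along \<open>u\<close>
  and the order of derivatives exchanged. The clause about the expansion along the
  \<open>v i\<close> is treated in the same way.\<close>

lemma solution_dir_deriv_unit: "solution (ball 0 1) (dir_deriv u F)"
proof -
  have line: "((\<lambda>t. dir_deriv w F (p + t *\<^sub>R u)) has_vector_derivative dir_deriv w (dir_deriv u F) p) (at 0)"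
    if "norm p < 1" for p w
  proof -
    have "dir_deriv w F differentiable (at (p + 0 *\<^sub>R u))"
      using C1_on_dir_deriv_unit[of w] that by (simp add: C1_on_def)
    from has_vector_derivative_line[OF this] show ?thesis
      by (simp add: second_derivative_symmetric[OF that])
  qed
  have "(\<Sum>i\<in>I. L i (dir_deriv (v i) (dir_deriv u F) p)) = 0" if "p \<in> ball 0 1" for p
  proof -
    have p: "norm p < 1" using that by simp
    have "((\<lambda>t. \<Sum>i\<in>I. L i (dir_deriv (v i) F (p + t *\<^sub>R u))) has_vector_derivative
        (\<Sum>i\<in>I. L i (dir_deriv (v i) (dir_deriv u F) p))) (at 0)"
    proof (rule has_vector_derivative_sum)
      fix i assume "i \<in> I"
      then have "bounded_linear (L i)" using linear_L linear_conv_bounded_linear by blast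
      from bounded_linear.has_vector_derivative[OF this line[OF p]]
      show "((\<lambda>t. L i (dir_deriv (v i) F (p + t *\<^sub>R u))) has_vector_derivative
          L i (dir_deriv (v i) (dir_deriv u F) p)) (at 0)" .
    qed
    moreover have "((\<lambda>t. \<Sum>i\<in>I. L i (dir_deriv (v i) F (p + t *\<^sub>R u))) has_vector_derivative 0) (at 0)"
      by (rule has_vector_derivative_transform_within_open[OF has_vector_derivative_const
          open_line_ball[of p u 1]]) (use p solution_eq[OF F unit_in_domain] in auto)
    ultimately show ?thesis by (rule vector_derivative_unique_at)
  qed
  moreover have "dir_deriv y (dir_deriv u F) p = (\<Sum>i\<in>I. (y \<bullet> v i) *\<^sub>R dir_deriv (v i) (dir_deriv u F) p)"
    if "p \<in> ball 0 1" for p y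
  proof -
    have p: "norm p < 1" using that by simp
    have "((\<lambda>t. \<Sum>i\<in>I. (y \<bullet> v i) *\<^sub>R dir_deriv (v i) F (p + t *\<^sub>R u)) has_vector_derivative
        (\<Sum>i\<in>I. (y \<bullet> v i) *\<^sub>R dir_deriv (v i) (dir_deriv u F) p)) (at 0)"
      by (rule has_vector_derivative_sum)
        (rule bounded_linear.has_vector_derivative[OF bounded_linear_scaleR_right line[OF p]])
    then have "((\<lambda>t. dir_deriv y F (p + t *\<^sub>R u)) has_vector_derivative
        (\<Sum>i\<in>I. (y \<bullet> v i) *\<^sub>R dir_deriv (v i) (dir_deriv u F) p)) (at 0)"
      by (rule has_vector_derivative_transform_within_open[OF _ open_line_ball[of p u 1]])
        (use p solution_expand[OF F unit_in_domain, symmetric] in auto)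
    with line[OF p, of y] show ?thesis by (rule vector_derivative_unique_at)
  qed
  ultimately show ?thesis
    using C1_on_dir_deriv_unit unfolding solution_def by blast
qed

lemma dir_deriv_bound_unit:
  assumes "\<And>z. z \<in> box2 \<Longrightarrow> norm (F z) \<le> K"
  shows "norm (dir_deriv u F 0) \<le> 4 * norm u * K * measure lborel (box2 :: 'a set) / bump_mass TYPE('a)"
proof -
  have "norm (mollify (bump_deriv u) F 0) \<le> (4 * norm u) * K * measure lborel (box2 :: 'a set)"
    by (rule norm_mollify_le[OF continuous_on_box2(1) continuous_kernel(2) _ _ abs_bump_deriv_le assms])
      (auto simp: bump_outside)
  moreover have "norm (bump_mass TYPE('a) *\<^sub>R dir_deriv u F 0) = norm (mollify (bump_deriv u) F 0)"
    using derivative_mean_value(2)[of 0 u] by simp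
  ultimately show ?thesis
    using integral_bump_pos[where 'a='a] by (simp add: pos_le_divide_eq mult.commute)
qed

end

section \<open>Rescaling, Cauchy estimates and local vanishing\<close>

lemma rescale_domain:
  fixes p :: 'a
  assumes "cball p d \<subseteq> D" "d > 0"
  defines "r \<equiv> d / (2 * DIM('a))"
  shows "box2 \<subseteq> {y. p + r *\<^sub>R y \<in> D}" "r > 0" "y \<in> box2 \<Longrightarrow> p + r *\<^sub>R y \<in> cball p d"
proof -
  show r: "r > 0" using assms by (simp add: r_def)
  have *: "p + r *\<^sub>R y \<in> cball p d" if "y \<in> box2" for y
  proof -
    \<comment> \<open>The origin of \<open>r\<close>: a point of \<open>box2\<close> has l1-norm,
      and thus norm, at most twice the dimension.\<close>
    have "norm y \<le> 2 * DIM('a)" using that cbox_subset_cball[of 2, where 'a='a] by auto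
    then have "r * norm y \<le> r * (2 * DIM('a))" using r by (intro mult_left_mono) auto
    then show ?thesis using assms(2) by (simp add: r_def dist_norm)
  qed
  then show "y \<in> box2 \<Longrightarrow> p + r *\<^sub>R y \<in> cball p d" .
  show "box2 \<subseteq> {y. p + r *\<^sub>R y \<in> D}" using * assms(1) by blast
qed

text \<open>Around each point the unit-scale result is applied to a magnified copy of
  \<open>F\<close> and carried back by the inverse magnification.\<close>

lemma solution_dir_deriv:
  assumes F: "solution D F"
  shows "solution D (dir_deriv u F)"
proof (rule solution_local)
  show oD: "open D" using solution_C1[OF F] by (simp add: C1_on_def)
  fix p assume "p \<in> D"
  then obtain d where d: "d > 0" "cball p d \<subseteq> D" using oD open_contains_cball by blast
  define r where "r = d / (2 * DIM('a))"
  note r = rescale_domain[OF d(2,1), folded r_def]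
  \<comment> \<open>The direction is divided by \<open>r\<close> to cancel the factor that the chain
    rule produces.\<close>
  define G where "G = dir_deriv ((1 / r) *\<^sub>R u) (\<lambda>y. F (p + r *\<^sub>R y))"
  \<comment> \<open>Makes \<open>x \<mapsto> q + (1 / r) *\<^sub>R x\<close> the inverse of
    \<open>y \<mapsto> p + r *\<^sub>R y\<close>.\<close>
  define q where "q = - ((1 / r) *\<^sub>R p)"
  let ?T = "{x. q + (1 / r) *\<^sub>R x \<in> ball 0 1}"
  have "solution (ball 0 1) G"
    unfolding G_def by (rule solution_dir_deriv_unit[OF solution_affine[OF F] r(1)])
  then have "solution ?T (\<lambda>x. G (q + (1 / r) *\<^sub>R x))"
    by (rule solution_affine)
  then have "solution ?T (dir_deriv u F)"
  proof (rule solution_cong)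
    fix x assume x: "x \<in> ?T"
    have e: "p + r *\<^sub>R (q + (1 / r) *\<^sub>R x) = x"
      using r(2) by (simp add: q_def scaleR_right_diff_distrib)
    have "q + (1 / r) *\<^sub>R x \<in> {y. p + r *\<^sub>R y \<in> D}"
      using unit_in_domain[OF solution_affine[OF F] r(1)] x by auto
    then have "x \<in> D" using e by simp
    then have diff: "F differentiable (at x)" using solution_C1[OF F] by (simp add: C1_on_def)
    have "G (q + (1 / r) *\<^sub>R x) = r *\<^sub>R dir_deriv ((1 / r) *\<^sub>R u) F x"
      unfolding G_def using dir_deriv_affine(2)[of F p r "q + (1 / r) *\<^sub>R x"] diff by (simp add: e)
    also have "\<dots> = dir_deriv u F x"
      using r(2) linear_cmul[OF has_derivative_linear[OF differentiable_dir_deriv[OF diff]], of "1 / r" u]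
      by simp
    finally show "G (q + (1 / r) *\<^sub>R x) = dir_deriv u F x" .
  qed
  moreover have "p \<in> ?T" by (simp add: q_def)
  ultimately show "\<exists>T. p \<in> T \<and> solution T (dir_deriv u F)"
    by (intro exI[of _ ?T] conjI)
qed

lemma solution_iterate: "solution D F \<Longrightarrow> solution D ((dir_deriv u ^^ k) F)"
  by (induction k) (auto intro: solution_dir_deriv)

text \<open>The constant is quantified before everything else because it is applied to all iterated
  derivatives of \<open>F\<close> on shrinking balls and must not change along the way.\<close>

lemma dir_deriv_estimate:
  "\<exists>C>0. \<forall>D F p d K u. solution D F \<longrightarrow> d > 0 \<longrightarrow> cball p d \<subseteq> D \<longrightarrow>
      (\<forall>x\<in>cball p d. norm (F x) \<le> K) \<longrightarrow> norm (dir_deriv u F p) \<le> C * norm u / d * K"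
proof -
  define B where "B = measure lborel (box2 :: 'a set)"
  define N where "N = 2 * real DIM('a)"
  define T where "T = bump_mass TYPE('a)"
  \<comment> \<open>4 is the bound on the gradient of the weight, \<open>B\<close> the volume of the
    box, \<open>T\<close> the mass of the weight and \<open>N\<close> comes from rescaling; adding 1
    ensures positivity.\<close>
  define C where "C = 4 * B / T * N + 1"
  have pos: "T > 0" "B \<ge> 0" "N > 0"
    by (simp_all only: T_def B_def integral_bump_pos measure_nonneg) (simp add: N_def)
  have C: "C > 0" unfolding C_def using pos by (intro add_nonneg_pos) auto
  have "norm (dir_deriv u F p) \<le> C * norm u / d * K"
    if F: "solution D F" and d: "d > 0" "cball p d \<subseteq> D" and K: "\<forall>x\<in>cball p d. norm (F x) \<le> K"
    for D F p d K u
  proof -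
    define r where "r = d / (2 * DIM('a))"
    note r = rescale_domain[OF d(2,1), folded r_def]
    have rN: "r = d / N" by (simp add: r_def N_def)
    have K0: "K \<ge> 0" using K d(1) norm_ge_zero[of "F p"] by (metis centre_in_cball less_imp_le order_trans)
    have "p \<in> D" using d by auto
    then have "dir_deriv u (\<lambda>y. F (p + r *\<^sub>R y)) 0 = r *\<^sub>R dir_deriv u F p"
      using dir_deriv_affine(2)[of F p r 0 u] solution_C1[OF F] by (simp add: C1_on_def)
    moreover have "norm (dir_deriv u (\<lambda>y. F (p + r *\<^sub>R y)) 0) \<le> 4 * norm u * K * B / T"
      unfolding B_def T_def
      by (rule dir_deriv_bound_unit[OF solution_affine[OF F] r(1)]) (use K r(3) in auto)
    ultimately have "r * norm (dir_deriv u F p) \<le> 4 * norm u * K * B / T"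
      using r(2) by simp
    then have "norm (dir_deriv u F p) \<le> 4 * norm u * K * B / T / r"
      by (simp only: pos_le_divide_eq[OF r(2)] mult.commute[of r])
    also have "\<dots> = (4 * B / T * N) * norm u / d * K"
      using d pos by (simp add: rN field_simps)
    also have "\<dots> \<le> C * norm u / d * K"
      unfolding C_def using K0 d by (intro mult_right_mono divide_right_mono) auto
    finally show ?thesis .
  qed
  with C show ?thesis by blast
qed

text \<open>Real analyticity in quantitative form: with all derivatives along the segment zero at
  \<open>p\<close>, \<open>F x\<close> equals each Taylor remainder, and these tend to zero
  geometrically.\<close>

lemma zero_near_of_iterates_zero:
  assumes F: "solution D F" and p: "p \<in> D" and zero: "\<And>u k. (dir_deriv u ^^ k) F p = 0"
  obtains r where "r > 0" "ball p r \<subseteq> D" "\<And>x. x \<in> ball p r \<Longrightarrow> F x = 0"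
proof -
  obtain C where C: "C > 0"
    and est: "\<And>D F p d K u. solution D F \<Longrightarrow> d > 0 \<Longrightarrow> cball p d \<subseteq> D \<Longrightarrow>
      (\<And>x. x \<in> cball p d \<Longrightarrow> norm (F x) \<le> K) \<Longrightarrow> norm (dir_deriv u F p) \<le> C * norm u / d * K"
    using dir_deriv_estimate by blast
  have "open D" using solution_C1[OF F] by (simp add: C1_on_def)
  then obtain d where d: "d > 0" "cball p d \<subseteq> D" using p open_contains_cball by blast
  define R where "R = d / 2"
  have R: "R > 0" "cball p (2 * R) \<subseteq> D" using d by (auto simp: R_def)
  have "compact (F ` cball p (2 * R))"
    using C1_on_continuous[OF solution_C1[OF F]] R(2)
    by (intro compact_continuous_image) (auto intro: continuous_on_subset)
  then obtain K where K: "\<And>x. x \<in> cball p (2 * R) \<Longrightarrow> norm (F x) \<le> K"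
    using compact_imp_bounded bounded_iff by (metis imageI)
  have K0: "K \<ge> 0" using order_trans[OF norm_ge_zero K[of p]] R by simp
  \<comment> \<open>Each of up to \<open>k\<close> Cauchy steps uses radius \<open>R / k\<close> and
    costs a factor \<open>C * norm u * k / R\<close>; after \<open>k\<close> steps the ball of
    radius \<open>2 * R\<close> has shrunk to radius \<open>R\<close>.\<close>
  have bound: "norm ((dir_deriv u ^^ j) F x) \<le> (C * norm u * k / R) ^ j * K"
    if "k > 0" "j \<le> k" "x \<in> cball p (2 * R - j * (R / k))" for u and j k :: nat and x
    using that(2,3)
  proof (induction j arbitrary: x)
    case 0
    then show ?case using K by simp
  next
    case (Suc j)
    have sub: "cball x (R / k) \<subseteq> cball p (2 * R - j * (R / k))"
    proof
      fix y assume "y \<in> cball x (R / k)"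
      then have "dist p y \<le> (2 * R - Suc j * (R / k)) + R / k"
        using Suc.prems dist_triangle[of p y x] by auto
      moreover have "Suc j * (R / k) = R / k + j * (R / k)"
        by (simp only: of_nat_Suc distrib_right mult_1_left)
      ultimately show "y \<in> cball p (2 * R - j * (R / k))" unfolding mem_cball by linarith
    qed
    also have "\<dots> \<subseteq> cball p (2 * R)" using R that by (simp add: subset_cball)
    also note R(2)
    finally have "norm (dir_deriv u ((dir_deriv u ^^ j) F) x) \<le> C * norm u / (R / k) * ((C * norm u * k / R) ^ j * K)"
      using R that Suc.IH Suc.prems sub by (intro est[OF solution_iterate[OF F]]) auto
    then show ?case by (simp add: mult.assoc)
  qed
  \<comment> \<open>The first bound keeps the segment from \<open>p\<close> within radius
    \<open>R\<close>; the second makes the ratio \<open>C * norm u * exp 1 / R\<close> at most one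
    half.\<close>
  define e where "e = min R (R / (2 * C * exp 1))"
  have e: "e > 0" "e \<le> R" "e \<le> R / (2 * C * exp 1)" using R C by (auto simp: e_def)
  show ?thesis
  proof
    show "e > 0" by fact
    have "ball p e \<subseteq> cball p (2 * R)" using e R by auto
    then show "ball p e \<subseteq> D" using R by blast
    fix x assume x: "x \<in> ball p e"
    define u where "u = x - p"
    have u: "norm u < e" using x by (simp add: u_def dist_norm norm_minus_commute)
    have seg: "p + t *\<^sub>R u \<in> cball p R" if "t \<in> {0..1}" for t
    proof -
      have "\<bar>t\<bar> * norm u \<le> 1 * norm u" using that by (intro mult_right_mono) auto
      then show ?thesis using u e by (simp add: dist_norm)
    qed
    have decay: "\<bar>F x \<bullet> b\<bar> \<le> K * (1/2) ^ k" if "k > 0" and b: "b \<in> Basis" for k b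
    proof -
      \<comment> \<open>Taylor's formula with Lagrange remainder holds for real functions, so it is
        applied to each coordinate, at an intermediate point depending on \<open>k\<close> and
        \<open>b\<close>.\<close>
      define diff where "diff = (\<lambda>m t. (dir_deriv u ^^ m) F (p + t *\<^sub>R u) \<bullet> b)"
      have "DERIV (diff m) t :> diff (Suc m) t" if "0 \<le> t" "t \<le> 1" for m t
      proof -
        have "p + t *\<^sub>R u \<in> D" using seg[of t] that R by (auto simp: subset_eq)
        then have "((\<lambda>t. (dir_deriv u ^^ m) F (p + t *\<^sub>R u)) has_vector_derivative
            (dir_deriv u ^^ Suc m) F (p + t *\<^sub>R u)) (at t)"
          using has_vector_derivative_line[of "(dir_deriv u ^^ m) F" p t u UNIV]
            solution_C1[OF solution_iterate[OF F]] by (simp add: C1_on_def)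
        from bounded_linear.has_vector_derivative[OF bounded_linear_inner_left this, of b]
        show ?thesis
          by (simp add: diff_def has_real_derivative_iff_has_vector_derivative)
      qed
      then obtain t where t: "0 < t" "t < 1"
        "diff 0 1 = (\<Sum>m<k. diff m 0 / fact m * 1 ^ m) + diff k t / fact k * 1 ^ k"
        using Maclaurin[of 1 k diff "diff 0"] \<open>k > 0\<close> by auto
      have "diff m 0 = 0" for m using zero by (simp add: diff_def)
      then have "F x \<bullet> b = diff k t / fact k" using t(3) by (simp add: diff_def u_def)
      moreover have "\<bar>diff k t\<bar> \<le> norm ((dir_deriv u ^^ k) F (p + t *\<^sub>R u))"
        unfolding diff_def by (rule Basis_le_norm[OF b])
      moreover have "norm ((dir_deriv u ^^ k) F (p + t *\<^sub>R u)) \<le> (C * norm u * k / R) ^ k * K"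
        using bound[of k k "p + t *\<^sub>R u" u] seg[of t] t \<open>k > 0\<close> by simp
      ultimately have "\<bar>F x \<bullet> b\<bar> \<le> (C * norm u * k / R) ^ k * K / fact k"
        by (simp add: divide_right_mono)
      also have "\<dots> = (C * norm u / R) ^ k * K / fact k * real k ^ k"
        by (simp add: power_mult_distrib power_divide)
      also have "\<dots> \<le> (C * norm u / R) ^ k * K / fact k * (fact k * exp 1 ^ k)"
        using K0 C R by (intro mult_left_mono power_self_le_fact_exp) auto
      also have "\<dots> = K * (C * norm u / R * exp 1) ^ k"
        by (subst power_mult_distrib) simp
      also have "\<dots> \<le> K * (1/2) ^ k"
      proof (intro mult_left_mono power_mono K0)
        have "norm u \<le> R / (2 * C * exp 1)" using u e by simp
        then have "norm u * (2 * C * exp 1) \<le> R" using C by (simp add: pos_le_divide_eq)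
        then have "(norm u * (2 * C * exp 1)) / (2 * R) \<le> R / (2 * R)"
          using R by (intro divide_right_mono) auto
        then show "C * norm u / R * exp 1 \<le> 1/2" using R by (simp add: mult.commute mult.left_commute)
      qed (use C R in auto)
      finally show ?thesis .
    qed
    have small: "\<bar>F x \<bullet> b\<bar> \<le> 0" if "b \<in> Basis" for b
    proof (rule LIMSEQ_le_const)
      show "(\<lambda>k. K * (1/2) ^ k) \<longlonglongrightarrow> 0"
        by (intro tendsto_mult_right_zero LIMSEQ_power_zero) simp
      show "\<exists>N. \<forall>k\<ge>N. \<bar>F x \<bullet> b\<bar> \<le> K * (1/2) ^ k"
        using decay that
        by (intro exI[of _ 1]) auto
    qed
    show "F x = 0" by (rule euclidean_eqI) (use small in simp)
  qed
qed

end

section \<open>Functions vanishing on a hypersurface\<close>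

text \<open>Ellipticity of the system. Composing with the sum of the
  \<open>c j *\<^sub>R L' j\<close> and adding the double sum to its transpose removes the
  off-diagonal terms; the squares remain.\<close>

lemma (in dirac_system) rank_one_kernel:
  assumes "(\<Sum>i\<in>I. L i (c i *\<^sub>R b)) = 0"
  shows "(\<Sum>i\<in>I. (c i)\<^sup>2) *\<^sub>R b = 0"
proof -
  define a where "a i j = L' j (L i ((c i * c j) *\<^sub>R b))" for i j
  have lin: "linear (\<lambda>x. L' i (L j x))" if "i \<in> I" "j \<in> I" for i j
    using linear_compose[OF linear_L[OF that(2)] linear_L'[OF that(1)]] by (simp add: o_def)
  have "(\<Sum>j\<in>I. \<Sum>i\<in>I. a i j) = (\<Sum>j\<in>I. c j *\<^sub>R L' j (\<Sum>i\<in>I. L i (c i *\<^sub>R b)))"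
    by (intro sum.cong refl)
      (simp add: a_def linear_sum[OF linear_L'] linear_cmul[OF lin] scaleR_right.sum mult.commute)
  also have "\<dots> = 0" by (simp add: assms linear_0[OF linear_L'])
  finally have 0: "(\<Sum>j\<in>I. \<Sum>i\<in>I. a i j) = 0" .
  have "a i j + a j i = (if i = j then 2 *\<^sub>R ((c i)\<^sup>2 *\<^sub>R b) else 0)" if "i \<in> I" "j \<in> I" for i j
  proof (cases "i = j")
    case True
    then show ?thesis using that by (simp add: a_def L'_L power2_eq_square flip: scaleR_left_distrib)
  next
    case False
    then show ?thesis
      using L'_L_anticommute[OF that False, of "(c i * c j) *\<^sub>R b"]
      by (simp add: a_def mult.commute add.commute)
  qed
  then have "(\<Sum>j\<in>I. \<Sum>i\<in>I. a i j + a j i) = (\<Sum>j\<in>I. \<Sum>i\<in>I. if i = j then 2 *\<^sub>R ((c i)\<^sup>2 *\<^sub>R b) else 0)"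
    by (intro sum.cong refl)
  also have "\<dots> = 2 *\<^sub>R ((\<Sum>i\<in>I. (c i)\<^sup>2) *\<^sub>R b)"
    by (simp add: finite_I scaleR_left.sum scaleR_right.sum)
  also have "(\<Sum>j\<in>I. \<Sum>i\<in>I. a i j + a j i) = (\<Sum>j\<in>I. \<Sum>i\<in>I. a i j) + (\<Sum>j\<in>I. \<Sum>i\<in>I. a j i)"
    by (simp add: sum.distrib)
  also have "(\<Sum>j\<in>I. \<Sum>i\<in>I. a j i) = (\<Sum>j\<in>I. \<Sum>i\<in>I. a i j)" by (rule sum.swap)
  finally show ?thesis using 0 by simp
qed

section \<open>Left multiplications by the hypercomplex basis as a system of this kind\<close>

context hypercomplex_subspace
begin

lemma m_less_DIM: "m < DIM('a)"
proof -
  have "card (v ` {..m}) \<le> DIM('a)" using independent_v independent_bound by blast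
  then show ?thesis using inj_v by (simp add: card_image)
qed

lemma v_inner: "i \<le> m \<Longrightarrow> j \<le> m \<Longrightarrow> v i \<bullet> v j = (if i = j then 1 else 0)"
  using m_less_DIM by (intro completed_orthonormal) auto

lemma linear_mul: "linear ((\<odot>) a)" "linear (\<lambda>a. a \<odot> b)"
  using bilinear_mul unfolding bilinear_def by blast+

lemma v_square: assumes "i \<in> {1..m}" shows "v i \<odot> v i = - e"
proof -
  have "conj (v i) = - v i" "v i \<odot> conj (v i) = e"
    using v_unit[OF assms] by (auto simp: imag_units_def trace_def sqnorm_def add_eq_0_iff)
  then have "- (v i \<odot> v i) = e" using linear_neg[OF linear_mul(1), of "v i" "v i"] by simp
  from arg_cong[OF this, of uminus] show ?thesis by simp
qed

lemma v_mul_v: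
  assumes "i \<in> {1..m}"
  shows "v i \<odot> (v i \<odot> x) = - x"
proof -
  have "v i \<odot> (v i \<odot> x) = (v i \<odot> v i) \<odot> x" using assoc_left[of "v i" x] by simp
  also have "\<dots> = - (e \<odot> x)"
    unfolding v_square[OF assms] using linear_neg[OF linear_mul(2), of e x] by simp
  finally show ?thesis by (simp add: unit_left)
qed

text \<open>Polarisation of the left alternative law: it is expanded for \<open>v i + v j\<close>,
  the square terms drop out by the law for each summand, and the products
  \<open>v i \<odot> v j\<close>, \<open>v j \<odot> v i\<close> cancel.\<close>

lemma v_mul_anticommute:
  assumes "i \<in> {1..m}" "j \<in> {1..m}" "i \<noteq> j"
  shows "v i \<odot> (v j \<odot> x) + v j \<odot> (v i \<odot> x) = 0"
proof -
  note lin = linear_add[OF linear_mul(1)] linear_add[OF linear_mul(2)]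
  let ?a = "v i + v j"
  have "(?a \<odot> ?a) \<odot> x = ?a \<odot> (?a \<odot> x)" using assoc_left[of ?a x] by simp
  moreover have "(v i \<odot> v i) \<odot> x = v i \<odot> (v i \<odot> x)" "(v j \<odot> v j) \<odot> x = v j \<odot> (v j \<odot> x)"
    using assoc_left[of "v i" x] assoc_left[of "v j" x] by simp_all
  moreover have "(v i \<odot> v j) \<odot> x + (v j \<odot> v i) \<odot> x = 0"
    using v_anticommute[OF assms] linear_neg[OF linear_mul(2)] by simp
  ultimately show ?thesis by (simp add: lin algebra_simps add_eq_0_iff)
qed

text \<open>For indices up to \<open>m\<close> this is \<open>conj (v i)\<close>, spelled out by
  cases: imaginary units have trace zero and so change sign.\<close>

definition v' :: "nat \<Rightarrow> 'a" where "v' i = (if i = 0 then e else - v i)"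

sublocale dirac_system "{..m}" v "\<lambda>i. (\<odot>) (v i)" "\<lambda>i. (\<odot>) (v' i)"
proof (rule dirac_system.intro)
  have neg: "(- a) \<odot> b = - (a \<odot> b)" for a b using linear_neg[OF linear_mul(2)] by simp
  show "v i \<bullet> v j = 0" if "i \<in> {..m}" "j \<in> {..m}" "i \<noteq> j" for i j
    using that by (simp add: v_inner)
  show "v' i \<odot> (v i \<odot> x) = x" if "i \<in> {..m}" for i x
    using that v_mul_v[of i x] by (cases "i = 0") (simp_all add: v'_def v_0 unit_left neg)
  show "v' i \<odot> (v j \<odot> x) + v' j \<odot> (v i \<odot> x) = 0" if "i \<in> {..m}" "j \<in> {..m}" "i \<noteq> j" for i j x
  proof (cases "i = 0 \<or> j = 0")
    case True
    then show ?thesis using that by (auto simp: v'_def v_0 unit_left neg)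
  next
    case False
    then show ?thesis using that v_mul_anticommute[of i j x]
      by (simp add: v'_def neg) (metis add.inverse_inverse add_eq_0_iff minus_add_distrib)
  qed
qed (rule finite_atMost linear_mul(1))+

definition proj :: "'a \<Rightarrow> 'a" where "proj x = (\<Sum>i\<le>m. (x \<bullet> v i) *\<^sub>R v i)"

lemma bounded_linear_proj: "bounded_linear proj"
  unfolding proj_def
  by (intro bounded_linear_sum bounded_linear_scaleR_const bounded_linear_inner_left)

lemmas linear_proj = bounded_linear.linear[OF bounded_linear_proj]

lemma proj_in_M: "proj x \<in> M"
  unfolding proj_def span_v[symmetric] by (intro span_sum span_scale span_base) auto

lemma proj_v: "j \<le> m \<Longrightarrow> proj (v j) = v j"
proof -
  assume "j \<le> m"
  then have "proj (v j) = (\<Sum>i\<le>m. if i = j then v j else 0)"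
    unfolding proj_def by (intro sum.cong) (auto simp: v_inner)
  then show "proj (v j) = v j" using \<open>j \<le> m\<close> by simp
qed

lemma proj_v_gt: "m < j \<Longrightarrow> j < DIM('a) \<Longrightarrow> proj (v j) = 0"
  by (simp add: proj_def completed_orthonormal)

lemma proj_eq: "x \<in> M \<Longrightarrow> proj x = x"
proof -
  assume "x \<in> M"
  then have "x \<in> span (v ` {..m})" by (simp add: span_v)
  from linear_eq_on_span[OF linear_proj linear_ident _ this] show "proj x = x"
    using proj_v by auto
qed

lemma proj_inner: "i \<le> m \<Longrightarrow> proj x \<bullet> v i = x \<bullet> v i"
proof -
  assume "i \<le> m"
  then have "proj x \<bullet> v i = (\<Sum>j\<le>m. if j = i then x \<bullet> v i else 0)"
    unfolding proj_def inner_sum_left by (intro sum.cong) (auto simp: v_inner)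
  then show "proj x \<bullet> v i = x \<bullet> v i" using \<open>i \<le> m\<close> by simp
qed

lemma orthonormal_expansion: "(\<Sum>i<DIM('a). (h \<bullet> v i) *\<^sub>R v i) = h"
proof -
  have lin: "linear (\<lambda>h. \<Sum>i<DIM('a). (h \<bullet> v i) *\<^sub>R v i)"
    by (intro bounded_linear.linear bounded_linear_sum bounded_linear_scaleR_const
        bounded_linear_inner_left)
  have "(\<Sum>i<DIM('a). (v j \<bullet> v i) *\<^sub>R v i) = v j" if "j < DIM('a)" for j
    using that by (simp add: completed_orthonormal if_distrib[of "\<lambda>x. x *\<^sub>R _"] cong: if_cong)
  then show ?thesis
    using linear_eq_on_span[OF lin linear_ident, of "v ` {..<DIM('a)}" h] completed_span by auto
qed

lemma open_proj_vimage:
  assumes "openin (top_of_set M) U"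
  shows "open (proj -` U)"
proof -
  obtain T where T: "open T" "U = M \<inter> T" using assms by (auto simp: openin_open)
  then have "proj -` U = proj -` T" using proj_in_M by auto
  then show ?thesis
    using open_vimage[OF T(1) linear_continuous_on[OF bounded_linear_proj, of UNIV]] by simp
qed

lemma Ck_on_1_derivative:
  assumes "Ck_on 1 (v ` {..m}) U q" "i \<le> m" "x \<in> U"
  shows "((\<lambda>t. q (x + t *\<^sub>R v i)) has_vector_derivative dir_deriv (v i) q x) (at 0)"
proof -
  have "(\<lambda>t. q (x + t *\<^sub>R v i)) differentiable (at 0)" using assms by simp
  then show ?thesis unfolding dir_deriv_def by (rule vector_derivative_works[THEN iffD1])
qed

lemma Ck_on_1_continuous:
  "Ck_on 1 (v ` {..m}) U q \<Longrightarrow> i \<le> m \<Longrightarrow> continuous_on U (dir_deriv (v i) q)"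
  by simp

text \<open>Along \<open>v i\<close> the extension has the partial derivative of \<open>q\<close> if
  \<open>i \<le> m\<close>, and it is constant if \<open>i > m\<close>. This turns partial
  derivatives on a subset of \<open>M\<close> into total derivatives on an open set of the
  algebra.\<close>

lemma C1_on_extend:
  fixes q :: "'a \<Rightarrow> 'b::real_normed_vector"
  assumes U: "openin (top_of_set M) U" and q: "Ck_on 1 (v ` {..m}) U q"
  shows "C1_on (proj -` U) (\<lambda>x. q (proj x))"
    "\<And>u x. x \<in> proj -` U \<Longrightarrow> dir_deriv u (\<lambda>x. q (proj x)) x = (\<Sum>i\<le>m. (u \<bullet> v i) *\<^sub>R dir_deriv (v i) q (proj x))"
proof -
  define g where "g i x = (if i \<le> m then dir_deriv (v i) q (proj x) else 0)" for i x
  have der: "((\<lambda>t. q (proj (y + t *\<^sub>R v i))) has_vector_derivative g i y) (at 0)"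
    if "i \<in> {..<DIM('a)}" "y \<in> proj -` U" for i y
  proof (cases "i \<le> m")
    case True
    then show ?thesis using Ck_on_1_derivative[OF q True, of "proj y"] that
      by (simp add: g_def linear_add[OF linear_proj] linear_cmul[OF linear_proj] proj_v)
  next
    case False
    then show ?thesis using that
      by (simp add: g_def linear_add[OF linear_proj] linear_cmul[OF linear_proj] proj_v_gt)
  qed
  have cont: "continuous_on (proj -` U) (g i)" for i
  proof (cases "i \<le> m")
    case True
    have "continuous_on (proj -` U) (\<lambda>x. dir_deriv (v i) q (proj x))"
      by (rule continuous_on_compose2[OF Ck_on_1_continuous[OF q True] linear_continuous_on[OF bounded_linear_proj]])
        auto
    then show ?thesis using True by (simp add: g_def)
  next
    case False
    then show ?thesis by (simp add: g_def)
  qed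
  note partials = C1_on_partials[OF open_proj_vimage[OF U], of "{..<DIM('a)}" "\<lambda>i h. h \<bullet> v i" v
      "\<lambda>x. q (proj x)" g, OF finite_lessThan bounded_linear_inner_left orthonormal_expansion der cont]
  show "C1_on (proj -` U) (\<lambda>x. q (proj x))" by (rule partials(1))
  fix u x assume x: "x \<in> proj -` U"
  have "dir_deriv u (\<lambda>x. q (proj x)) x = (\<Sum>i<DIM('a). (u \<bullet> v i) *\<^sub>R g i x)"
    by (rule partials(2)[OF _ _ x])
  also have "\<dots> = (\<Sum>i\<le>m. (u \<bullet> v i) *\<^sub>R g i x)"
    using m_less_DIM by (intro sum.mono_neutral_right) (auto simp: g_def)
  finally show "dir_deriv u (\<lambda>x. q (proj x)) x = (\<Sum>i\<le>m. (u \<bullet> v i) *\<^sub>R dir_deriv (v i) q (proj x))"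
    by (simp add: g_def)
qed

lemma solution_extend_diff:
  assumes \<Omega>: "openin (top_of_set M) \<Omega>"
    and f: "monogenic_on mul v m \<Omega> f" and g: "monogenic_on mul v m \<Omega> g"
  shows "solution (proj -` \<Omega>) (\<lambda>x. f (proj x) - g (proj x))"
proof -
  define q where "q x = f x - g x" for x
  have Cf: "Ck_on 1 (v ` {..m}) \<Omega> f" and Cg: "Ck_on 1 (v ` {..m}) \<Omega> g"
    using f g by (auto simp: monogenic_on_def)
  have der: "((\<lambda>t. q (x + t *\<^sub>R v i)) has_vector_derivative dir_deriv (v i) f x - dir_deriv (v i) g x) (at 0)"
    if "i \<le> m" "x \<in> \<Omega>" for i x
    unfolding q_def using that
    by (intro has_vector_derivative_diff Ck_on_1_derivative[OF Cf] Ck_on_1_derivative[OF Cg])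
  then have dq: "dir_deriv (v i) q x = dir_deriv (v i) f x - dir_deriv (v i) g x"
    if "i \<le> m" "x \<in> \<Omega>" for i x
    using that by (simp add: dir_deriv_def[of _ q] vector_derivative_at)
  have cont: "continuous_on \<Omega> (dir_deriv (v i) q)" if "i \<le> m" for i
  proof -
    have "continuous_on \<Omega> (\<lambda>x. dir_deriv (v i) f x - dir_deriv (v i) g x)"
      using that by (intro continuous_on_diff Ck_on_1_continuous[OF Cf] Ck_on_1_continuous[OF Cg])
    then show ?thesis by (rule continuous_on_eq) (simp add: dq that)
  qed
  have Cq: "Ck_on 1 (v ` {..m}) \<Omega> q"
    using differentiableI_vector[OF der] cont by auto
  note ext = C1_on_extend[OF \<Omega> Cq]
  have dv: "dir_deriv (v i) (\<lambda>x. q (proj x)) x = dir_deriv (v i) q (proj x)"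
    if "i \<le> m" "x \<in> proj -` \<Omega>" for i x
    using that by (simp add: ext(2) v_inner if_distrib[of "\<lambda>x. x *\<^sub>R _"] cong: if_cong)
  have "(\<Sum>i\<le>m. v i \<odot> dir_deriv (v i) (\<lambda>x. q (proj x)) x) = 0" if "x \<in> proj -` \<Omega>" for x
  proof -
    have "(\<Sum>i\<le>m. v i \<odot> dir_deriv (v i) (\<lambda>x. q (proj x)) x)
      = (\<Sum>i\<le>m. v i \<odot> dir_deriv (v i) f (proj x)) - (\<Sum>i\<le>m. v i \<odot> dir_deriv (v i) g (proj x))"
      using that by (simp add: dv dq linear_diff[OF linear_mul(1)] sum_subtractf)
    then show ?thesis using f g that by (simp add: monogenic_on_def)
  qed
  moreover have "dir_deriv y (\<lambda>x. q (proj x)) x = (\<Sum>i\<le>m. (y \<bullet> v i) *\<^sub>R dir_deriv (v i) (\<lambda>x. q (proj x)) x)"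
    if "x \<in> proj -` \<Omega>" for x y
    unfolding ext(2)[OF that, of y] by (intro sum.cong refl) (simp add: dv[OF _ that])
  ultimately show ?thesis
    using ext(1) unfolding solution_def q_def by blast
qed

section \<open>Vanishing of the gradient on the hypersurface, and continuation\<close>

lemma dim_M: "dim M = m + 1"
proof -
  have "dim (v ` {..m}) = m + 1"
    using dim_eq_card_independent[OF independent_v] inj_v by (simp add: card_image)
  then show ?thesis using dim_span[of "v ` {..m}"] by (simp only: span_v)
qed

lemma dim_hyperplane: "dim (v ` {..<m}) = m"
proof -
  have "independent (v ` {..<m})" by (rule independent_mono[OF independent_v]) auto
  then have "dim (v ` {..<m}) = card (v ` {..<m})" by (rule dim_eq_card_independent)
  moreover have "inj_on v {..<m}" by (rule inj_on_subset[OF inj_v]) auto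
  ultimately show ?thesis by (simp add: card_image)
qed

text \<open>Through the chart the tangent directions at \<open>p\<close> form an
  \<open>m\<close>-dimensional subspace of \<open>M\<close> that the derivative of \<open>G\<close>
  kills. One transversal vector remains in \<open>M\<close>, which gives the rank-one form excluded
  by ellipticity.\<close>

lemma gradient_zero_on_hypersurface:
  assumes G: "solution (proj -` \<Omega>) G" and \<Omega>: "openin (top_of_set M) \<Omega>"
    and S: "smooth_submanifold v m m \<Omega> S" and zero: "\<And>x. x \<in> S \<Longrightarrow> G x = 0" and p: "p \<in> S"
  shows "dir_deriv u G p = 0"
proof -
  have \<Omega>M: "\<Omega> \<subseteq> M" using openin_subset[OF \<Omega>] by simp
  obtain U V \<phi> \<psi> where pU: "p \<in> U" and U: "openin (top_of_set \<Omega>) U" and V: "openin (top_of_set M) V"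
    and hom: "homeomorphism U V \<phi> \<psi>"
    and "smooth_map_on (v ` {..m}) U \<phi>" "smooth_map_on (v ` {..m}) V \<psi>"
    and flat: "\<phi> ` (S \<inter> U) = V \<inter> span (v ` {..<m})"
    using S p unfolding smooth_submanifold_def span_v by meson
  then have C1: "Ck_on 1 (v ` {..m}) U \<phi>" "Ck_on 1 (v ` {..m}) V \<psi>"
    unfolding smooth_map_on_def by blast+
  have UM: "openin (top_of_set M) U" using openin_trans[OF U \<Omega>] .
  have S\<Omega>: "S \<subseteq> \<Omega>" using S by (simp add: smooth_submanifold_def)
  define \<Phi> where "\<Phi> x = \<phi> (proj x)" for x
  define \<Psi> where "\<Psi> x = \<psi> (proj x)" for x
  define q where "q = \<phi> p"
  let ?W = "span (v ` {..<m})"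
  have WM: "?W \<subseteq> M" unfolding span_v[symmetric] by (intro span_mono) auto
  have qVW: "q \<in> V" "q \<in> ?W" using flat p pU by (auto simp: q_def)
  have \<psi>q: "\<psi> q = p" using hom pU by (simp add: q_def homeomorphism_def)
  have \<Psi>q: "\<Psi> q = p" using qVW WM \<psi>q by (auto simp: \<Psi>_def proj_eq)
  have pD: "p \<in> proj -` \<Omega>" "p \<in> proj -` U" and qD: "q \<in> proj -` V"
    using p S\<Omega> \<Omega>M pU qVW WM by (auto simp: proj_eq subset_iff)
  note ext\<Phi> = C1_on_extend[OF UM C1(1), folded \<Phi>_def]
  note ext\<Psi> = C1_on_extend[OF V C1(2), folded \<Psi>_def]
  have d\<Psi>: "(\<Psi> has_derivative (\<lambda>u. dir_deriv u \<Psi> q)) (at q)"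
    using ext\<Psi>(1) qD by (intro differentiable_dir_deriv) (simp add: C1_on_def)
  have d\<Phi>: "(\<Phi> has_derivative (\<lambda>u. dir_deriv u \<Phi> p)) (at (\<Psi> q))"
    using ext\<Phi>(1) pD unfolding \<Psi>q by (intro differentiable_dir_deriv) (simp add: C1_on_def)
  have dG: "(G has_derivative (\<lambda>u. dir_deriv u G p)) (at (\<Psi> q))"
    using solution_C1[OF G] pD unfolding \<Psi>q by (intro differentiable_dir_deriv) (simp add: C1_on_def)
  \<comment> \<open>Projecting makes \<open>T w \<in> M\<close> immediate; the derivatives of
    \<open>G\<close> and \<open>\<Phi>\<close> at \<open>p\<close> depend only on the
    \<open>M\<close>-component, so nothing else changes.\<close>
  define T where "T w = proj (dir_deriv w \<Psi> q)" for w
  have linT: "linear T"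
    using linear_compose[OF has_derivative_linear[OF d\<Psi>] linear_proj] by (simp add: T_def[abs_def] o_def)
  \<comment> \<open>A short segment in the flat hyperplane lies in \<open>V\<close> and is carried
    into \<open>S\<close> by the inverse chart, which gives curves in \<open>S\<close> with
    prescribed chart velocity.\<close>
  have near: "\<exists>\<epsilon>>0. \<forall>t. \<bar>t\<bar> < \<epsilon> \<longrightarrow> \<Psi> (q + t *\<^sub>R w) \<in> S \<and> \<Phi> (\<Psi> (q + t *\<^sub>R w)) = q + t *\<^sub>R w"
    if w: "w \<in> ?W" for w
  proof -
    have "open {t. q + t *\<^sub>R w \<in> proj -` V}"
      using open_vimage[OF open_proj_vimage[OF V], of "\<lambda>t. q + t *\<^sub>R w"]
      by (simp add: vimage_def continuous_intros)
    moreover have "0 \<in> {t. q + t *\<^sub>R w \<in> proj -` V}" using qD by simp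
    ultimately obtain \<epsilon> where \<epsilon>: "\<epsilon> > 0" "ball 0 \<epsilon> \<subseteq> {t. q + t *\<^sub>R w \<in> proj -` V}"
      by (rule openE)
    have "\<Psi> (q + t *\<^sub>R w) \<in> S \<and> \<Phi> (\<Psi> (q + t *\<^sub>R w)) = q + t *\<^sub>R w" if "\<bar>t\<bar> < \<epsilon>" for t
    proof -
      let ?y = "q + t *\<^sub>R w"
      have yW: "?y \<in> ?W" using w qVW by (intro span_add span_scale)
      then have y: "proj ?y = ?y" using WM by (auto simp: proj_eq)
      have "t \<in> ball 0 \<epsilon>" using that by simp
      then have "?y \<in> V" using \<epsilon>(2) y by auto
      then obtain s where s: "s \<in> S" "s \<in> U" "?y = \<phi> s" using flat yW by blast
      then have "\<psi> ?y = s" using hom by (simp add: homeomorphism_def)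
      then show ?thesis using s y S\<Omega> \<Omega>M by (auto simp: \<Psi>_def \<Phi>_def proj_eq subset_iff)
    qed
    then show ?thesis using \<epsilon>(1) by blast
  qed
  have line: "((\<lambda>t. H (\<Psi> (q + t *\<^sub>R w))) has_vector_derivative H' (dir_deriv w \<Psi> q)) (at 0)"
    if "(H has_derivative H') (at (\<Psi> q))" for H :: "'a \<Rightarrow> 'a" and H' w
  proof -
    have d: "(H \<circ> \<Psi> has_derivative H' \<circ> (\<lambda>u. dir_deriv u \<Psi> q)) (at q)"
      by (rule diff_chain_at[OF d\<Psi> that])
    then have "(H \<circ> \<Psi>) differentiable (at (q + 0 *\<^sub>R w))" by (auto simp: differentiable_def)
    from has_vector_derivative_line[OF this, of UNIV] show ?thesis
      using dir_deriv_eq[OF d, of w] by (simp add: o_def)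
  qed
  have expand: "dir_deriv (proj y) G p = dir_deriv y G p" for y
    using solution_expand[OF G pD(1), of y] solution_expand[OF G pD(1), of "proj y"]
    by (simp add: proj_inner)
  \<comment> \<open>Along such a curve \<open>G\<close> is constantly zero and \<open>\<Phi>\<close>
    returns the straight segment; comparing derivatives at 0 yields both facts, and the second makes
    \<open>T\<close> injective on the hyperplane.\<close>
  have T_kernel: "dir_deriv (T w) G p = 0" and T_inv: "dir_deriv (T w) \<Phi> p = w" if w: "w \<in> ?W" for w
  proof -
    obtain \<epsilon> where \<epsilon>: "\<epsilon> > 0" "\<And>t. \<bar>t\<bar> < \<epsilon> \<Longrightarrow> \<Psi> (q + t *\<^sub>R w) \<in> S"
      "\<And>t. \<bar>t\<bar> < \<epsilon> \<Longrightarrow> \<Phi> (\<Psi> (q + t *\<^sub>R w)) = q + t *\<^sub>R w"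
      using near[OF w] by blast
    have "((\<lambda>t. G (\<Psi> (q + t *\<^sub>R w))) has_vector_derivative 0) (at 0)"
      by (rule has_vector_derivative_transform_within_open[OF has_vector_derivative_const open_ball[of 0 \<epsilon>]])
        (use \<epsilon> zero in auto)
    then have "dir_deriv (dir_deriv w \<Psi> q) G p = 0"
      using line[OF dG, of w] by (metis vector_derivative_unique_at)
    then show "dir_deriv (T w) G p = 0" by (simp add: T_def expand)
    have "((\<lambda>t. q + t *\<^sub>R w) has_vector_derivative w) (at 0)"
      by (auto intro!: derivative_eq_intros)
    then have "((\<lambda>t. \<Phi> (\<Psi> (q + t *\<^sub>R w))) has_vector_derivative w) (at 0)"
      by (rule has_vector_derivative_transform_within_open[OF _ open_ball[of 0 \<epsilon>]])
        (use \<epsilon> in auto)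
    then have "dir_deriv (dir_deriv w \<Psi> q) \<Phi> p = w"
      using line[OF d\<Phi>, of w] by (metis vector_derivative_unique_at)
    then show "dir_deriv (T w) \<Phi> p = w"
      using ext\<Phi>(2)[OF pD(2)] by (simp add: T_def proj_inner)
  qed
  have "inj_on T ?W" using T_inv by (metis inj_onI)
  then have dimT: "dim (T ` ?W) = m"
    using dim_image_eq[OF linT, of ?W] by (simp add: dim_hyperplane span_span)
  have sub: "subspace (T ` ?W)" using linT by (intro linear_subspace_image subspace_span)
  have TM: "T ` ?W \<subseteq> M" using proj_in_M by (auto simp: T_def)
  have spanT: "span (T ` ?W) = T ` ?W" using sub by (rule span_eq_iff[THEN iffD2])
  have "T ` ?W \<noteq> M" using dimT dim_M by auto
  then obtain w0 where w0: "w0 \<in> M" "w0 \<notin> T ` ?W" using TM by blast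
  then have dim0: "dim (insert w0 (T ` ?W)) = m + 1" by (simp add: dim_insert spanT dimT)
  have "span (insert w0 (T ` ?W)) = span M"
    using w0 TM dim_M dim0 by (intro dim_eq_span) auto
  then have "v i \<in> span (insert w0 (T ` ?W))" if "i \<le> m" for i
    using that span_v span_superset[of "v ` {..m}"] span_superset[of M] by auto
  \<comment> \<open>Modulo tangent vectors each \<open>v i\<close> is a multiple of the transversal
    vector \<open>w0\<close>; the multiples are the covector \<open>c\<close>.\<close>
  then have "\<forall>i\<in>{..m}. \<exists>k. v i - k *\<^sub>R w0 \<in> T ` ?W"
    by (simp add: span_breakdown_eq spanT)
  then obtain c where c: "\<And>i. i \<le> m \<Longrightarrow> v i - c i *\<^sub>R w0 \<in> T ` ?W"
    using bchoice[of "{..m}" "\<lambda>i k. v i - k *\<^sub>R w0 \<in> T ` ?W"] by auto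
  define b where "b = dir_deriv w0 G p"
  have lin: "linear (\<lambda>u. dir_deriv u G p)" by (rule has_derivative_linear[OF dG])
  have vb: "dir_deriv (v i) G p = c i *\<^sub>R b" if "i \<le> m" for i
  proof -
    have "dir_deriv (v i - c i *\<^sub>R w0) G p = 0" using c[OF that] T_kernel by auto
    then show ?thesis
      using linear_diff[OF lin, of "v i" "c i *\<^sub>R w0"] linear_cmul[OF lin, of "c i" w0] by (simp add: b_def)
  qed
  have "(\<Sum>i\<le>m. v i \<odot> (c i *\<^sub>R b)) = 0"
    using solution_eq[OF G pD(1)] by (simp add: vb)
  then have "(\<Sum>i\<le>m. (c i)\<^sup>2) *\<^sub>R b = 0" by (rule rank_one_kernel)
  \<comment> \<open>Either \<open>b = 0\<close>, or the real sum of squares vanishes and with it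
    every \<open>c i\<close>.\<close>
  then have "c i *\<^sub>R b = 0" if "i \<le> m" for i
    using that by (auto simp: sum_nonneg_eq_0_iff)
  then have "dir_deriv (v i) G p = 0" if "i \<le> m" for i using vb that by simp
  then show ?thesis using solution_expand[OF G pD(1), of u] by simp
qed

text \<open>A clopen argument for the set \<open>Z\<close> of points where all pure iterated
  derivatives vanish: Cauchy estimates make it open and continuity of the iterates makes it
  closed.\<close>

lemma solution_eq_zero:
  assumes F: "solution (proj -` \<Omega>) F" and \<Omega>: "openin (top_of_set M) \<Omega>" "connected \<Omega>"
    and S: "smooth_submanifold v m m \<Omega> S" "S \<noteq> {}" and zero: "\<And>x. x \<in> S \<Longrightarrow> F x = 0"
    and x: "x \<in> \<Omega>"
  shows "F x = 0"
proof -
  have \<Omega>D: "\<Omega> \<subseteq> proj -` \<Omega>" using openin_subset[OF \<Omega>(1)] by (auto simp: proj_eq)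
  have S\<Omega>: "S \<subseteq> \<Omega>" using S by (simp add: smooth_submanifold_def)
  define Z where "Z = {x \<in> \<Omega>. \<forall>u k. (dir_deriv u ^^ k) F x = 0}"
  have "(dir_deriv u ^^ k) F x = 0" if "x \<in> S" for u k x
    using that
  proof (induction k arbitrary: x)
    case 0
    then show ?case by (simp add: zero)
  next
    \<comment> \<open>The gradient lemma is applied to the \<open>k\<close>-th iterate, which is
      itself a solution and vanishes on \<open>S\<close> by induction.\<close>
    case (Suc k)
    then show ?case
      using gradient_zero_on_hypersurface[OF solution_iterate[OF F] \<Omega>(1) S(1)] by simp
  qed
  then have "S \<subseteq> Z" using S\<Omega> by (auto simp: Z_def)
  moreover have "openin (top_of_set \<Omega>) Z"
    unfolding openin_contains_ball
  proof (intro conjI ballI)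
    show "Z \<subseteq> \<Omega>" by (auto simp: Z_def)
    fix z assume z: "z \<in> Z"
    then have "z \<in> proj -` \<Omega>" "\<And>u k. (dir_deriv u ^^ k) F z = 0" using \<Omega>D by (auto simp: Z_def)
    then obtain r where r: "r > 0" "\<And>y. y \<in> ball z r \<Longrightarrow> F y = 0"
      using zero_near_of_iterates_zero[OF F] by blast
    have "(dir_deriv u ^^ k) F y = 0" if "y \<in> ball z r" for u k y
      using that by (induction k arbitrary: y) (auto simp: r intro: dir_deriv_zero_open(2)[OF open_ball])
    then show "\<exists>e>0. ball z e \<inter> \<Omega> \<subseteq> Z" using r(1) by (auto simp: Z_def)
  qed
  moreover have "closedin (top_of_set \<Omega>) Z"
  proof -
    have "closedin (top_of_set \<Omega>) {x \<in> \<Omega>. (dir_deriv u ^^ k) F x = 0}" for u k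
      using C1_on_continuous[OF solution_C1[OF solution_iterate[OF F]]] \<Omega>D
      by (intro continuous_closedin_preimage_constant) (rule continuous_on_subset)
    then have "closedin (top_of_set \<Omega>) (\<Inter>a. {x \<in> \<Omega>. (dir_deriv (fst a) ^^ snd a) F x = 0})"
      by (intro closedin_INT) auto
    moreover have "(\<Inter>a. {x \<in> \<Omega>. (dir_deriv (fst a) ^^ snd a) F x = 0}) = Z"
      by (auto simp: Z_def)
    ultimately show ?thesis by simp
  qed
  ultimately have "Z = \<Omega>" using \<Omega>(2) S(2) unfolding connected_clopen by blast
  \<comment> \<open>The zeroth iterate is \<open>F\<close> itself; the direction is
    arbitrary.\<close>
  then have "(dir_deriv 0 ^^ 0) F x = 0" using x unfolding Z_def by blast
  then show ?thesis by simp
qed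

end

theorem theorem2p19:
  fixes mul :: "'a::euclidean_space \<Rightarrow> 'a \<Rightarrow> 'a"
    and e :: 'a
    and conj :: "'a \<Rightarrow> 'a"
    and M \<Omega> S :: "'a set"
    and m :: nat
    and v :: "nat \<Rightarrow> 'a"
    and f g :: "'a \<Rightarrow> 'a"
  assumes "hypercomplex_subspace mul e conj M m v"
    and "openin (top_of_set M) \<Omega>"
    and "connected \<Omega>"
    and "monogenic_on mul v m \<Omega> f"
    and "monogenic_on mul v m \<Omega> g"
    and "smooth_submanifold v m m \<Omega> S"
    and "S \<noteq> {}"
    and "\<forall>x\<in>S. f x = g x"
  shows "\<forall>x\<in>\<Omega>. f x = g x"
proof
  interpret hypercomplex_subspace mul e conj M m v by fact
  fix x assume x: "x \<in> \<Omega>"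
  have M: "\<Omega> \<subseteq> M" "S \<subseteq> \<Omega>"
    using openin_subset[OF assms(2)] assms(6) by (auto simp: smooth_submanifold_def)
  have "f (proj x) - g (proj x) = 0"
    by (rule solution_eq_zero[OF solution_extend_diff[OF assms(2,4,5)] assms(2,3,6,7) _ x])
      (use assms(8) M in \<open>auto simp: proj_eq subset_iff\<close>)
  then show "f x = g x" using x M by (auto simp: proj_eq subset_iff)
qed

end
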